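(* Let $\Omega$ be a non-empty open connected subset of $\mathbb C^n$, $n\in\mathbb N$, and let $H\neq\{0\}$ be a Hilbert space of holomorphic functions on $\Omega$ such that for every $z\in\Omega$ the point evaluation functional $f\mapsto f(z)$, $f\in H$, is bounded. Suppose that every non-constant bounded holomorphic function $\phi:\Omega\to\mathbb C$ is a multiplier of $H$ such that $\|M_\phi\|=\|\phi\|_\infty$. Then for each such $\phi$ (that is, each non-constant bounded holomorphic function $\phi$ on $\Omega$) the following are equivalent: (i) $M_\phi^*$ is topologically multiply recurrent. (ii) $M_\phi^*$ is recurrent. (iii) $M_\phi^*$ is frequently hypercyclic. (iv) $M_\phi^*$ is hypercyclic. (v) $\phi(\Omega)\cap\mathbb T\neq\emptyset$. (vi) $M_\phi^*$ has property $\mathcal A$.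
   Context: $\mathbb N$ denotes the set of positive integers and $\mathbb T$ the unit circle in $\mathbb C$. A function $\phi:\Omega\to\mathbb C$ is a *multiplier* of $H$ if the pointwise product $\phi f$ belongs to $H$ for every $f\in H$; in that case $M_\phi:H\to H$, $M_\phi f=\phi f$, is a bounded linear operator, $M_\phi^*$ denotes its Hilbert space adjoint, and $\|\phi\|_\infty=\sup_{z\in\Omega}|\phi(z)|$. For $B\subset\mathbb N$ the lower and upper densities are $\underline{\mathrm d}(B)=\liminf_{N\to\infty}\frac{|\{n\in B:n\le N\}|}{N}$ and $\overline{\mathrm d}(B)=\limsup_{N\to\infty}\frac{|\{n\in B:n\le N\}|}{N}$. Let $S$ be a bounded linear operator on a Banach space $X$, and write $S^{-j}U=(S^j)^{-1}(U)$. - $S$ is *hypercyclic* if there is $x\in X$ such that $\{S^nx:n=0,1,2,\ldots\}$ is dense in $X$. - $S$ is *frequently hypercyclic* if there is $x\in X$ such that for every non-empty open $U\subset X$ the set $\{n\in\mathbb N:S^nx\in U\}$ has positive lower density. - $S$ is *recurrent* if for every non-empty open $U\subset X$ there is a positive integer $k$ with $U\cap S^{-k}U\neq\emptyset$. - $S$ is *topologically multiply recurrent* if for every non-empty open $U\subset X$ and every positive integer $m$ there is a positive integer $k$ with $U\cap S^{-k}U\cap\cdots\cap S^{-mk}U\neq\emptyset$. - $S$ has *property $\mathcal A$* if for every non-empty open $U\subset X$ there is $x\in X$ such that $\overline{\mathrm d}(\{n\in\mathbb N:S^nx\in U\})>0$. *)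

theory Defs
  imports "HOL-Analysis.Analysis"
begin

section \<open>Complex Hilbert spaces\<close>

class scaleC = scaleR +
  fixes scaleC :: "complex \<Rightarrow> 'a \<Rightarrow> 'a"  (infixr "*\<^sub>C" 75)

class complex_vector = scaleC + real_vector +
  assumes scaleC_add_right: "a *\<^sub>C (x + y) = a *\<^sub>C x + a *\<^sub>C y"
    and scaleC_add_left: "(a + b) *\<^sub>C x = a *\<^sub>C x + b *\<^sub>C x"
    and scaleC_scaleC: "a *\<^sub>C b *\<^sub>C x = (a * b) *\<^sub>C x"
    and scaleR_scaleC: "r *\<^sub>R x = complex_of_real r *\<^sub>C x"

text \<open>The inner product is linear in its first and conjugate-linear in its second argument.\<close>

class complex_inner = complex_vector + real_normed_vector +
  fixes cinner :: "'a \<Rightarrow> 'a \<Rightarrow> complex"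
  assumes cinner_commute: "cinner x y = cnj (cinner y x)"
    and cinner_add_left: "cinner (x + y) z = cinner x z + cinner y z"
    and cinner_scaleC_left: "cinner (a *\<^sub>C x) y = a * cinner x y"
    and cinner_ge_zero: "0 \<le> Re (cinner x x)"
    and cinner_eq_zero_iff: "cinner x x = 0 \<longleftrightarrow> x = 0"
    and norm_eq_sqrt_cinner: "norm x = sqrt (Re (cinner x x))"

class chilbert_space = complex_inner + complete_space

definition cadjoint :: "('a::complex_inner \<Rightarrow> 'a) \<Rightarrow> 'a \<Rightarrow> 'a" where
  "cadjoint T = (SOME T'. \<forall>x y. cinner (T x) y = cinner x (T' y))"


section \<open>Hilbert spaces of holomorphic functions\<close>

text \<open>Holomorphy in several complex variables: Frechet differentiability with a
  complex-linear derivative. It is used for open \<open>S\<close> only.\<close>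

definition cholomorphic_on :: "(complex ^ 'n \<Rightarrow> complex) \<Rightarrow> (complex ^ 'n) set \<Rightarrow> bool" where
  "cholomorphic_on f S \<longleftrightarrow>
     (\<forall>z\<in>S. \<exists>D. (f has_derivative D) (at z within S) \<and> (\<forall>c v. D (c *s v) = c * D v))"

definition bounded_nonconstant_cholomorphic ::
    "(complex ^ 'n) set \<Rightarrow> (complex ^ 'n \<Rightarrow> complex) \<Rightarrow> bool" where
  "bounded_nonconstant_cholomorphic \<Omega> \<phi> \<longleftrightarrow>
     cholomorphic_on \<phi> \<Omega> \<and> bounded (\<phi> ` \<Omega>) \<and> \<not> \<phi> constant_on \<Omega>"

definition sup_norm_on :: "'b set \<Rightarrow> ('b \<Rightarrow> complex) \<Rightarrow> real" where
  "sup_norm_on \<Omega> \<phi> = (SUP z\<in>\<Omega>. norm (\<phi> z))"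

text \<open>The space is the type \<open>'h\<close>; an element \<open>f :: 'h\<close> is the function \<open>z \<mapsto> ev f z\<close> on \<open>\<Omega>\<close>.
  The axiom \<open>ev_inject\<close> says that elements of the space are identified with their
  functions on \<open>\<Omega>\<close>; the values of \<open>ev f\<close> outside \<open>\<Omega>\<close> are irrelevant.\<close>

locale holomorphic_hilbert_space =
  fixes \<Omega> :: "(complex ^ 'n) set"
    and ev :: "'h::chilbert_space \<Rightarrow> complex ^ 'n \<Rightarrow> complex"
  assumes ev_add: "z \<in> \<Omega> \<Longrightarrow> ev (f + g) z = ev f z + ev g z"
    and ev_scaleC: "z \<in> \<Omega> \<Longrightarrow> ev (c *\<^sub>C f) z = c * ev f z"
    and ev_inject: "(\<And>z. z \<in> \<Omega> \<Longrightarrow> ev f z = ev g z) \<Longrightarrow> f = g"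
    and ev_holomorphic: "cholomorphic_on (ev f) \<Omega>"
    and ev_bounded: "z \<in> \<Omega> \<Longrightarrow> \<exists>K. \<forall>f. norm (ev f z) \<le> K * norm f"

definition multiplier ::
    "'b set \<Rightarrow> ('h \<Rightarrow> 'b \<Rightarrow> complex) \<Rightarrow> ('b \<Rightarrow> complex) \<Rightarrow> bool" where
  "multiplier \<Omega> ev \<phi> \<longleftrightarrow> (\<forall>f. \<exists>g. \<forall>z\<in>\<Omega>. ev g z = \<phi> z * ev f z)"

definition mult_op ::
    "'b set \<Rightarrow> ('h \<Rightarrow> 'b \<Rightarrow> complex) \<Rightarrow> ('b \<Rightarrow> complex) \<Rightarrow> 'h \<Rightarrow> 'h" where
  "mult_op \<Omega> ev \<phi> f = (THE g. \<forall>z\<in>\<Omega>. ev g z = \<phi> z * ev f z)"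


section \<open>Linear dynamics\<close>

text \<open>The densities are those of the set of positive elements of \<open>B\<close>.\<close>

definition lower_density :: "nat set \<Rightarrow> ereal" where
  "lower_density B = liminf (\<lambda>N. ereal (real (card {n\<in>B. 1 \<le> n \<and> n \<le> N}) / real N))"

definition upper_density :: "nat set \<Rightarrow> ereal" where
  "upper_density B = limsup (\<lambda>N. ereal (real (card {n\<in>B. 1 \<le> n \<and> n \<le> N}) / real N))"

definition hypercyclic :: "('a::topological_space \<Rightarrow> 'a) \<Rightarrow> bool" where
  "hypercyclic S \<longleftrightarrow> (\<exists>x. closure (range (\<lambda>n. (S ^^ n) x)) = UNIV)"

definition frequently_hypercyclic :: "('a::topological_space \<Rightarrow> 'a) \<Rightarrow> bool" where
  "frequently_hypercyclic S \<longleftrightarrow>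
     (\<exists>x. \<forall>U. open U \<and> U \<noteq> {} \<longrightarrow> lower_density {n. 1 \<le> n \<and> (S ^^ n) x \<in> U} > 0)"

definition recurrent :: "('a::topological_space \<Rightarrow> 'a) \<Rightarrow> bool" where
  "recurrent S \<longleftrightarrow>
     (\<forall>U. open U \<and> U \<noteq> {} \<longrightarrow> (\<exists>k\<ge>1. U \<inter> (S ^^ k) -` U \<noteq> {}))"

definition topologically_multiply_recurrent :: "('a::topological_space \<Rightarrow> 'a) \<Rightarrow> bool" where
  "topologically_multiply_recurrent S \<longleftrightarrow>
     (\<forall>U. open U \<and> U \<noteq> {} \<longrightarrow>
       (\<forall>m\<ge>1. \<exists>k\<ge>1. U \<inter> (\<Inter>j\<in>{1..m}. (S ^^ (j * k)) -` U) \<noteq> {}))"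

definition property_A :: "('a::topological_space \<Rightarrow> 'a) \<Rightarrow> bool" where
  "property_A S \<longleftrightarrow>
     (\<forall>U. open U \<and> U \<noteq> {} \<longrightarrow> (\<exists>x. upper_density {n. 1 \<le> n \<and> (S ^^ n) x \<in> U} > 0))"

end

theory Submission
  imports Defs "HOL-Complex_Analysis.Complex_Analysis"
begin

text \<open>The adjoint \<open>T\<close> of multiplication by \<open>\<phi>\<close> sends the reproducing kernel at \<open>z\<close> to \<open>cnj (\<phi> z)\<close> times itself.

  If \<open>\<bar>\<phi>\<bar>\<close> takes the value \<open>1\<close>, then over an arc of the unit circle the kernels form a smooth
  family of unimodular eigenvectors. Integrating it against a bump function times \<open>exp (i n t)\<close>
  gives a two-sided orbit \<open>y n\<close> of \<open>T\<close> with \<open>norm (y n) = O(n\<^sup>-\<^sup>2)\<close>, and the vectors \<open>y 0\<close> obtained in this way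
  span a dense subspace. Superposing translates of such orbits along sparse but well separated times
  yields frequently hypercyclic and multiply recurrent vectors.

  If \<open>\<bar>\<phi>\<bar>\<close> omits the value \<open>1\<close>, then by connectedness \<open>T\<close>, or the adjoint of multiplication by \<open>1 / \<phi>\<close>, which inverts it,
  is a contraction with an eigenvalue of modulus less than \<open>1\<close>, and such a map is not recurrent.
  Each of the other dynamical properties implies recurrence.\<close>

section \<open>Complex Hilbert spaces\<close>

text \<open>No Hilbert-space-valued integral is formed. For fixed \<open>n\<close> the bump-weighted
  integral over the arc is a bounded functional on the space, and \<open>y n\<close> is its Riesz
  representative. The quadratic decay is visible only for one function at a time; the uniform
  boundedness principle turns it into a bound on \<open>norm (y n)\<close>. The bump has double
  zeros at both ends of the arc so that two integrations by parts leave no boundary terms, and decay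
  of order two is summable over the integers. The negative half of an orbit replaces a right inverse
  of \<open>T\<close>: the point at index \<open>- s\<close> reaches \<open>y 0\<close> after
  \<open>s\<close> steps. Two obstacles determine the choice of arc: in several variables
  \<open>\<phi>\<close> is not locally invertible, hence the restriction to complex lines; on a line
  its derivative may vanish at the given unimodular point, hence the move to a nearby one.\<close>

instance chilbert_space \<subseteq> banach ..

definition complex_homogeneous :: "('a::complex_vector \<Rightarrow> 'b::complex_vector) \<Rightarrow> bool" where
  "complex_homogeneous L \<longleftrightarrow> (\<forall>c x. L (c *\<^sub>C x) = c *\<^sub>C L x)"

definition complex_functional :: "('a::complex_vector \<Rightarrow> complex) \<Rightarrow> bool" where
  "complex_functional L \<longleftrightarrow> (\<forall>c x. L (c *\<^sub>C x) = c * L x)"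

lemma cinner_add_right: "cinner x (y + z) = cinner x y + cinner x z"
  by (metis cinner_add_left cinner_commute complex_cnj_add)

lemma cinner_scaleC_right: "cinner x (a *\<^sub>C y) = cnj a * cinner x y"
  by (metis cinner_commute cinner_scaleC_left complex_cnj_mult)

lemma cinner_zero_left [simp]: "cinner 0 y = 0"
  using cinner_add_left[of 0 0 y] by simp

lemma cinner_zero_right [simp]: "cinner x 0 = 0"
  using cinner_add_right[of x 0 0] by simp

lemma cinner_minus_left: "cinner (- x) y = - cinner x y"
  using cinner_add_left[of x "- x" y] by (simp add: eq_neg_iff_add_eq_0 add.commute)

lemma cinner_minus_right: "cinner x (- y) = - cinner x y"
  using cinner_add_right[of x y "- y"] by (simp add: eq_neg_iff_add_eq_0 add.commute)

lemma cinner_diff_left: "cinner (x - y) z = cinner x z - cinner y z"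
  using cinner_add_left[of x "- y" z] by (simp add: cinner_minus_left)

lemma cinner_diff_right: "cinner x (y - z) = cinner x y - cinner x z"
  using cinner_add_right[of x y "- z"] by (simp add: cinner_minus_right)

lemma scaleC_one [simp]: "1 *\<^sub>C x = (x :: 'a :: complex_vector)"
  using scaleR_scaleC[of 1 x] by simp

lemma scaleC_zero_left [simp]: "0 *\<^sub>C x = (0 :: 'a :: complex_vector)"
  using scaleR_scaleC[of 0 x] by simp

lemma scaleC_zero_right [simp]: "c *\<^sub>C 0 = (0 :: 'a :: complex_vector)"
  using scaleC_add_right[of c 0 0] by simp

lemma scaleC_minus_left: "(- c) *\<^sub>C x = - (c *\<^sub>C (x :: 'a :: complex_vector))"
  using scaleC_add_left[of c "- c" x] by (simp add: eq_neg_iff_add_eq_0 add.commute)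

lemma scaleC_minus_right: "c *\<^sub>C (- x) = - (c *\<^sub>C (x :: 'a :: complex_vector))"
  using scaleC_add_right[of c x "- x"] by (simp add: eq_neg_iff_add_eq_0 add.commute)

lemma scaleC_diff_right: "c *\<^sub>C (x - y) = c *\<^sub>C x - c *\<^sub>C (y :: 'a :: complex_vector)"
  using scaleC_add_right[of c x "- y"] by (simp add: scaleC_minus_right)

lemma scaleC_diff_left: "(c - d) *\<^sub>C x = c *\<^sub>C x - d *\<^sub>C (x :: 'a :: complex_vector)"
  using scaleC_add_left[of c "- d" x] by (simp add: scaleC_minus_left)

lemma cinner_self: "cinner x x = of_real ((norm x)\<^sup>2)"
proof -
  have "Im (cinner x x) = 0"
    by (metis Reals_cnj_iff cinner_commute complex_is_Real_iff)
  then show ?thesis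
    by (simp add: norm_eq_sqrt_cinner cinner_ge_zero complex_eq_iff)
qed

lemma complex_mult_cnj_cmod: "z * cnj z = (complex_of_real (cmod z))\<^sup>2"
  by (simp flip: complex_norm_square of_real_power)

lemma norm_scaleC: "norm (c *\<^sub>C x) = cmod c * norm (x :: 'a :: complex_inner)"
proof -
  have "complex_of_real ((norm (c *\<^sub>C x))\<^sup>2) = cinner (c *\<^sub>C x) (c *\<^sub>C x)"
    by (simp only: cinner_self)
  also have "\<dots> = (c * cnj c) * cinner x x"
    by (simp add: cinner_scaleC_left cinner_scaleC_right)
  also have "\<dots> = of_real ((cmod c * norm x)\<^sup>2)"
    by (simp add: complex_mult_cnj_cmod cinner_self power_mult_distrib)
  finally have "complex_of_real ((norm (c *\<^sub>C x))\<^sup>2) = of_real ((cmod c * norm x)\<^sup>2)" .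
  then have "(norm (c *\<^sub>C x))\<^sup>2 = (cmod c * norm x)\<^sup>2"
    using of_real_eq_iff by blast
  then show ?thesis
    by (simp add: power2_eq_iff_nonneg)
qed

lemma norm_add_square:
  "(norm (x + y))\<^sup>2 = (norm x)\<^sup>2 + (norm y)\<^sup>2 + 2 * Re (cinner x (y :: 'a :: complex_inner))"
proof -
  have "(norm (x + y))\<^sup>2 = Re (cinner (x + y) (x + y))"
    by (simp add: cinner_self)
  also have "\<dots> = Re (cinner x x) + Re (cinner y y) + Re (cinner x y) + Re (cinner y x)"
    by (simp add: cinner_add_left cinner_add_right)
  also have "Re (cinner y x) = Re (cinner x y)"
    by (metis cinner_commute cnj.simps(1))
  finally show ?thesis
    by (simp add: cinner_self)
qed

lemma norm_diff_square:
  "(norm (x - y))\<^sup>2 = (norm x)\<^sup>2 + (norm y)\<^sup>2 - 2 * Re (cinner x (y :: 'a :: complex_inner))"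
  using norm_add_square[of x "- y"] by (simp add: cinner_minus_right)

lemma parallelogram_law:
  "(norm (x + y))\<^sup>2 + (norm (x - y))\<^sup>2 = 2 * (norm x)\<^sup>2 + 2 * (norm (y :: 'a :: complex_inner))\<^sup>2"
  by (simp add: norm_add_square norm_diff_square)

text \<open>Pythagoras for the component of \<open>x\<close> along \<open>u\<close>. It yields both
  Cauchy-Schwarz and the orthogonality of the residual of a nearest point.\<close>

lemma norm_diff_component_square:
  fixes x u :: "'a :: complex_inner"
  assumes "u \<noteq> 0"
  shows "(norm (x - (cinner x u / of_real ((norm u)\<^sup>2)) *\<^sub>C u))\<^sup>2
           = (norm x)\<^sup>2 - (cmod (cinner x u))\<^sup>2 / (norm u)\<^sup>2"
proof -
  define c where "c = cinner x u"
  have "cnj (c / of_real ((norm u)\<^sup>2)) * c = of_real ((cmod c)\<^sup>2 / (norm u)\<^sup>2)"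
    by (simp add: complex_mult_cnj_cmod mult.commute)
  then have "Re (cinner x ((c / of_real ((norm u)\<^sup>2)) *\<^sub>C u)) = (cmod c)\<^sup>2 / (norm u)\<^sup>2"
    unfolding cinner_scaleC_right c_def[symmetric] by (metis Re_complex_of_real)
  moreover have "(norm ((c / of_real ((norm u)\<^sup>2)) *\<^sub>C u))\<^sup>2 = (cmod c)\<^sup>2 / (norm u)\<^sup>2"
    using assms by (simp add: norm_scaleC norm_divide norm_mult power2_eq_square)
  ultimately show ?thesis
    unfolding norm_diff_square c_def[symmetric] by simp
qed

lemma cinner_Cauchy_Schwarz:
  "cmod (cinner x y) \<le> norm x * norm (y :: 'a :: complex_inner)"
proof (cases "y = 0")
  case False
  have "0 \<le> (norm x)\<^sup>2 - (cmod (cinner x y))\<^sup>2 / (norm y)\<^sup>2"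
    using norm_diff_component_square[OF False, of x] by (metis zero_le_power2)
  then have "(cmod (cinner x y))\<^sup>2 \<le> (norm x * norm y)\<^sup>2"
    using False by (simp add: field_simps power_mult_distrib)
  then show ?thesis
    by (meson abs_le_square_iff mult_nonneg_nonneg norm_ge_zero power2_le_imp_le)
qed simp

lemma bounded_linear_cinner_left: "bounded_linear (\<lambda>x. cinner x (y :: 'a :: complex_inner))"
proof (rule bounded_linear_intro[where K = "norm y"])
  show "cinner (r *\<^sub>R x) y = r *\<^sub>R cinner x y" for r x
    by (simp add: scaleR_scaleC cinner_scaleC_left scaleR_conv_of_real)
qed (auto simp: cinner_add_left cinner_Cauchy_Schwarz)

lemma bounded_linear_cinner_right: "bounded_linear (\<lambda>y. cinner (x :: 'a :: complex_inner) y)"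
proof (rule bounded_linear_intro[where K = "norm x"])
  show "cinner x (r *\<^sub>R y) = r *\<^sub>R cinner x y" for r y
    by (simp add: scaleR_scaleC cinner_scaleC_right scaleR_conv_of_real)
  show "cmod (cinner x y) \<le> norm y * norm x" for y
    using cinner_Cauchy_Schwarz[of x y] by (simp add: mult.commute)
qed (simp add: cinner_add_right)

lemma bounded_linear_scaleC: "bounded_linear (\<lambda>x. c *\<^sub>C (x :: 'a :: complex_inner))"
proof (rule bounded_linear_intro[where K = "cmod c"])
  show "c *\<^sub>C r *\<^sub>R x = r *\<^sub>R c *\<^sub>C x" for r and x :: 'a
    by (simp add: scaleR_scaleC scaleC_scaleC mult.commute)
qed (auto simp: scaleC_add_right norm_scaleC)

lemma cinner_ext:
  fixes x y :: "'a :: complex_inner"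
  assumes "\<And>z. cinner z x = cinner z y"
  shows "x = y"
proof -
  have "cinner (x - y) (x - y) = 0"
    using assms[of "x - y"] by (simp add: cinner_diff_right)
  then show ?thesis
    by (simp add: cinner_eq_zero_iff)
qed

section \<open>Orthogonal projection, density and Riesz representation\<close>

definition csubspace :: "'a::complex_vector set \<Rightarrow> bool" where
  "csubspace V \<longleftrightarrow> 0 \<in> V \<and> (\<forall>x\<in>V. \<forall>y\<in>V. x + y \<in> V) \<and> (\<forall>c. \<forall>x\<in>V. c *\<^sub>C x \<in> V)"

lemma csubspace_closure:
  fixes V :: "'a :: complex_inner set"
  assumes "csubspace V"
  shows "csubspace (closure V)"
  unfolding csubspace_def
proof (intro conjI ballI allI)
  show "0 \<in> closure V"
    using assms closure_subset unfolding csubspace_def by blast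
  show "x + y \<in> closure V" if x: "x \<in> closure V" and y: "y \<in> closure V" for x y
  proof -
    obtain a where "\<And>n. a n \<in> V" "a \<longlonglongrightarrow> x"
      using x closure_sequential by blast
    moreover obtain b where "\<And>n. b n \<in> V" "b \<longlonglongrightarrow> y"
      using y closure_sequential by blast
    ultimately have "(\<lambda>n. a n + b n) \<longlonglongrightarrow> x + y" "\<And>n. a n + b n \<in> V"
      using assms unfolding csubspace_def by (auto intro: tendsto_add)
    then show ?thesis
      unfolding closure_sequential by (intro exI[of _ "\<lambda>n. a n + b n"]) auto
  qed
  show "c *\<^sub>C x \<in> closure V" if x: "x \<in> closure V" for c x
  proof -
    obtain a where "\<And>n. a n \<in> V" "a \<longlonglongrightarrow> x"
      using x closure_sequential by blast
    then have "(\<lambda>n. c *\<^sub>C a n) \<longlonglongrightarrow> c *\<^sub>C x" "\<And>n. c *\<^sub>C a n \<in> V"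
      using assms bounded_linear.tendsto[OF bounded_linear_scaleC] unfolding csubspace_def by auto
    then show ?thesis
      unfolding closure_sequential by (intro exI[of _ "\<lambda>n. c *\<^sub>C a n"]) auto
  qed
qed

text \<open>A minimising sequence for the distance to \<open>V\<close> is Cauchy by the
  parallelogram law. If the residual at the limit had a component along some \<open>u\<close> in
  \<open>V\<close>, subtracting it would shorten the residual further.\<close>

lemma orthogonal_projection_exists:
  fixes V :: "'a :: chilbert_space set"
  assumes "closed V" and V: "csubspace V"
  obtains v where "v \<in> V" "\<And>u. u \<in> V \<Longrightarrow> cinner (x - v) u = 0"
proof -
  define g where "g v = (norm (x - v))\<^sup>2" for v
  define d where "d = Inf (g ` V)"
  have ne: "V \<noteq> {}"
    using V unfolding csubspace_def by auto
  have bdd: "bdd_below (g ` V)"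
    by (rule bdd_belowI[where m = 0]) (auto simp: g_def)
  have d_le: "d \<le> g v" if "v \<in> V" for v
    unfolding d_def using that bdd by (simp add: cInf_lower)
  have "\<exists>v\<in>V. g v < d + 1 / (real n + 1)" for n
  proof -
    have "Inf (g ` V) < d + 1 / (real n + 1)"
      unfolding d_def by simp
    then show ?thesis
      using cInf_lessD[of "g ` V"] ne by (auto simp: d_def)
  qed
  then obtain s where sV: "\<And>n. s n \<in> V" and s: "\<And>n. g (s n) < d + 1 / (real n + 1)"
    by metis
  have dist_s: "(norm (s m - s n))\<^sup>2 \<le> 2 / (real m + 1) + 2 / (real n + 1)" for m n
  proof -
    \<comment> \<open>The midpoint of two near-minimisers is again at distance at least
      \<open>sqrt d\<close>, so the parallelogram law leaves little room for their
      difference.\<close>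
    have "(1/2) *\<^sub>C (s m + s n) \<in> V"
      using V sV unfolding csubspace_def by auto
    then have "d \<le> (norm (x - (1/2) *\<^sub>C (s m + s n)))\<^sup>2"
      using d_le unfolding g_def by blast
    moreover have "(x - s m) + (x - s n) = 2 *\<^sub>C (x - (1/2) *\<^sub>C (s m + s n))"
    proof -
      have "2 *\<^sub>C x = x + x"
        using scaleC_add_left[of 1 1 x] by simp
      then show ?thesis
        by (simp add: scaleC_diff_right scaleC_scaleC algebra_simps)
    qed
    ultimately have "4 * d \<le> (norm ((x - s m) + (x - s n)))\<^sup>2"
      by (simp add: norm_scaleC power_mult_distrib)
    moreover have "(norm ((x - s m) - (x - s n)))\<^sup>2 = (norm (s m - s n))\<^sup>2"
      by (simp add: norm_minus_commute)
    ultimately have "(norm (s m - s n))\<^sup>2 \<le> 2 * g (s m) + 2 * g (s n) - 4 * d"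
      using parallelogram_law[of "x - s m" "x - s n"] unfolding g_def by linarith
    moreover have "2 / (real m + 1) = 2 * (1 / (real m + 1))" "2 / (real n + 1) = 2 * (1 / (real n + 1))"
      by auto
    ultimately show ?thesis
      using s[of m] s[of n] by linarith
  qed
  have "Cauchy s"
  proof (rule CauchyI)
    fix e :: real assume e: "e > 0"
    obtain N where N: "4 / e\<^sup>2 < real N"
      using reals_Archimedean2 by blast
    have "norm (s m - s n) < e" if "m \<ge> N" "n \<ge> N" for m n
    proof -
      have "2 / (real m + 1) < e\<^sup>2 / 2" "2 / (real n + 1) < e\<^sup>2 / 2"
      proof -
        have "4 < e\<^sup>2 * (real k + 1)" if "k \<ge> N" for k
        proof -
          have "4 < e\<^sup>2 * real N"
            using N e by (simp add: field_simps)
          also have "\<dots> \<le> e\<^sup>2 * (real k + 1)"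
            using that by (intro mult_left_mono) auto
          finally show ?thesis .
        qed
        then show "2 / (real m + 1) < e\<^sup>2 / 2" "2 / (real n + 1) < e\<^sup>2 / 2"
          using that by (simp_all add: field_simps)
      qed
      then have "(norm (s m - s n))\<^sup>2 < e\<^sup>2"
        using dist_s[of m n] by linarith
      then show ?thesis
        using e by (simp add: power2_less_imp_less)
    qed
    then show "\<exists>M. \<forall>m\<ge>M. \<forall>n\<ge>M. norm (s m - s n) < e"
      by blast
  qed
  then obtain v where v: "s \<longlonglongrightarrow> v"
    using Cauchy_convergent convergent_def by blast
  have vV: "v \<in> V"
    using \<open>closed V\<close> sV v closed_sequentially by blast
  have "(\<lambda>n. d + 1 / (real n + 1)) \<longlonglongrightarrow> d + 0"
    by (intro tendsto_add tendsto_const) real_asymp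
  moreover have "(\<lambda>n. g (s n)) \<longlonglongrightarrow> g v"
    unfolding g_def by (intro tendsto_intros v)
  ultimately have gv: "g v \<le> d"
    using s LIMSEQ_le[of "\<lambda>n. g (s n)" "g v" "\<lambda>n. d + 1 / (real n + 1)" "d + 0"]
    by (auto intro: less_imp_le)
  have "cinner (x - v) u = 0" if u: "u \<in> V" for u
  proof (cases "u = 0")
    case False
    define c where "c = cinner (x - v) u / of_real ((norm u)\<^sup>2)"
    have "v + c *\<^sub>C u \<in> V"
      using V vV u unfolding csubspace_def by blast
    then have "g v \<le> (norm (x - v - c *\<^sub>C u))\<^sup>2"
      using gv d_le[of "v + c *\<^sub>C u"] unfolding g_def diff_diff_eq by linarith
    then have "(cmod (cinner (x - v) u))\<^sup>2 / (norm u)\<^sup>2 \<le> 0"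
      using norm_diff_component_square[OF False, of "x - v"] unfolding g_def c_def by linarith
    then show ?thesis
      using False by (simp add: divide_le_0_iff)
  qed simp
  with vV show ?thesis
    using that by blast
qed

text \<open>The residual of the projection onto \<open>closure V\<close> is orthogonal to
  \<open>V\<close>. Every density claim about a subspace below is reduced to orthogonality in this
  way.\<close>

lemma dense_if_orthogonal_trivial:
  fixes V :: "'a :: chilbert_space set"
  assumes "csubspace V" "\<And>x. (\<And>v. v \<in> V \<Longrightarrow> cinner x v = 0) \<Longrightarrow> x = 0"
  shows "closure V = UNIV"
proof -
  have "x \<in> closure V" for x
  proof -
    obtain v where v: "v \<in> closure V" "\<And>u. u \<in> closure V \<Longrightarrow> cinner (x - v) u = 0"
      using orthogonal_projection_exists[OF closed_closure csubspace_closure[OF assms(1)]] by metis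
    then have "x - v = 0"
      using assms(2) closure_subset by blast
    then show ?thesis
      using v by simp
  qed
  then show ?thesis by auto
qed

text \<open>The kernel of \<open>L\<close> is a closed hyperplane. With \<open>w\<close> orthogonal
  to it, \<open>z - (L z / L w) *\<^sub>C w\<close> lies in the kernel, and pairing it with
  \<open>w\<close> reads off \<open>L z\<close>.\<close>

lemma Riesz_representation:
  fixes L :: "'a :: chilbert_space \<Rightarrow> complex"
  assumes L: "bounded_linear L" and hom: "complex_functional L"
  obtains y where "\<And>x. L x = cinner x y"
proof (cases "\<forall>x. L x = 0")
  case True
  then show ?thesis
    using that[of 0] by simp
next
  case False
  interpret L: bounded_linear L by (rule L)
  define V where "V = {x. L x = 0}"
  have "closed V"
    unfolding V_def using L by (intro closed_Collect_eq) (auto intro: linear_continuous_on)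
  moreover have V: "csubspace V"
    using hom unfolding V_def csubspace_def complex_functional_def
    by (auto simp: L.add L.zero)
  moreover obtain x where x: "L x \<noteq> 0"
    using False by blast
  ultimately obtain v where v: "v \<in> V" "\<And>u. u \<in> V \<Longrightarrow> cinner (x - v) u = 0"
    using orthogonal_projection_exists by metis
  define w where "w = x - v"
  have w: "L w \<noteq> 0"
    using x v(1) by (simp add: w_def V_def L.diff)
  then have nw: "norm w \<noteq> 0"
    using L.zero by auto
  have "L z = cinner z ((cnj (L w) / of_real ((norm w)\<^sup>2)) *\<^sub>C w)" for z
  proof -
    have "z - (L z / L w) *\<^sub>C w \<in> V"
      using hom w unfolding V_def complex_functional_def by (simp add: L.diff)
    then have "cinner w (z - (L z / L w) *\<^sub>C w) = 0"
      using v(2) w_def by blast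
    then have "cinner (z - (L z / L w) *\<^sub>C w) w = 0"
      by (metis cinner_commute complex_cnj_zero)
    then have "cinner z w = (L z / L w) * of_real ((norm w)\<^sup>2)"
      by (simp add: cinner_diff_left cinner_scaleC_left cinner_self)
    then show ?thesis
      using w nw by (simp add: cinner_scaleC_right)
  qed
  then show ?thesis
    using that by blast
qed

section \<open>Adjoints of bounded operators\<close>

lemma cadjoint_works:
  fixes M :: "'a :: chilbert_space \<Rightarrow> 'a"
  assumes M: "bounded_linear M" and hom: "complex_homogeneous M"
  shows "cinner (M x) y = cinner x (cadjoint M y)"
proof -
  have "\<exists>z. \<forall>x. cinner (M x) y = cinner x z" for y
  proof -
    have "bounded_linear (\<lambda>x. cinner (M x) y)"
      using bounded_linear_compose[OF bounded_linear_cinner_left M] by simp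
    moreover have "complex_functional (\<lambda>x. cinner (M x) y)"
      using hom by (simp add: complex_functional_def complex_homogeneous_def cinner_scaleC_left)
    ultimately show ?thesis
      using Riesz_representation by metis
  qed
  then obtain M' where "\<forall>x y. cinner (M x) y = cinner x (M' y)"
    by metis
  then have "\<forall>x y. cinner (M x) y = cinner x (cadjoint M y)"
    unfolding cadjoint_def
    by (rule someI[where P = "\<lambda>T'. \<forall>x y. cinner (M x) y = cinner x (T' y)"])
  then show ?thesis by blast
qed

lemma norm_le_if_cinner_le:
  fixes y :: "'a :: complex_inner"
  assumes "0 \<le> K" "\<And>x. cmod (cinner x y) \<le> K * norm x"
  shows "norm y \<le> K"
proof (cases "y = 0")
  case False
  have "norm y * norm y \<le> K * norm y"
    using assms(2)[of y] by (simp add: cinner_self norm_power power2_eq_square norm_mult)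
  then show ?thesis
    using False by simp
qed (use assms in auto)

lemma cadjoint_bounded_linear_homogeneous:
  fixes M :: "'a :: chilbert_space \<Rightarrow> 'a"
  assumes M: "bounded_linear M" and hom: "complex_homogeneous M"
  shows "bounded_linear (cadjoint M)" "complex_homogeneous (cadjoint M)"
proof -
  note ad = cadjoint_works[OF assms]
  obtain K where K: "K > 0" "\<And>x. norm (M x) \<le> norm x * K"
    using bounded_linear.pos_bounded[OF M] by blast
  show c: "complex_homogeneous (cadjoint M)"
    unfolding complex_homogeneous_def
    by (intro allI cinner_ext) (simp add: ad[symmetric] cinner_scaleC_right)
  show "bounded_linear (cadjoint M)"
  proof (rule bounded_linear_intro[where K = K])
    show "cadjoint M (x + y) = cadjoint M x + cadjoint M y" for x y
      by (rule cinner_ext) (simp add: ad[symmetric] cinner_add_right)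
    show "cadjoint M (r *\<^sub>R x) = r *\<^sub>R cadjoint M x" for r x
      using c by (simp add: scaleR_scaleC complex_homogeneous_def)
    show "norm (cadjoint M y) \<le> norm y * K" for y
    proof (rule norm_le_if_cinner_le)
      show "cmod (cinner x (cadjoint M y)) \<le> norm y * K * norm x" for x
      proof -
        have "cmod (cinner (M x) y) \<le> norm (M x) * norm y"
          by (rule cinner_Cauchy_Schwarz)
        also have "\<dots> \<le> (norm x * K) * norm y"
          by (intro mult_right_mono K) auto
        finally show ?thesis
          by (simp add: ad mult_ac)
      qed
    qed (use K in auto)
  qed
qed

lemma norm_cadjoint_le_onorm:
  fixes M :: "'a :: chilbert_space \<Rightarrow> 'a"
  assumes M: "bounded_linear M" and hom: "complex_homogeneous M"
  shows "norm (cadjoint M y) \<le> onorm M * norm y"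
proof (rule norm_le_if_cinner_le)
  show "cmod (cinner x (cadjoint M y)) \<le> onorm M * norm y * norm x" for x
  proof -
    have "cmod (cinner (M x) y) \<le> norm (M x) * norm y"
      by (rule cinner_Cauchy_Schwarz)
    also have "\<dots> \<le> (onorm M * norm x) * norm y"
      by (intro mult_right_mono onorm M) auto
    finally show ?thesis
      by (simp add: cadjoint_works[OF assms] mult_ac)
  qed
qed (simp add: onorm_pos_le[OF M])

text \<open>By Baire some set \<open>A k\<close>, on which all operators are bounded by
  \<open>k\<close>, contains a ball. A vector of norm \<open>e\<close> is a difference of two points
  of that ball, whence the constant \<open>2 * k / e\<close>.\<close>

lemma uniform_boundedness:
  fixes F :: "'i \<Rightarrow> 'a::banach \<Rightarrow> 'b::real_normed_vector"
  assumes lin: "\<And>i. i \<in> I \<Longrightarrow> bounded_linear (F i)"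
    and ptw: "\<And>x. \<exists>K. \<forall>i\<in>I. norm (F i x) \<le> K"
  obtains K where "0 \<le> K" "\<And>i x. i \<in> I \<Longrightarrow> norm (F i x) \<le> K * norm x"
proof -
  define A where "A k = (\<Inter>i\<in>I. {x. norm (F i x) \<le> real k})" for k :: nat
  have closed: "closed (A k)" for k
    unfolding A_def using lin
    by (intro closed_INT ballI closed_Collect_le continuous_intros linear_continuous_on) auto
  have cover: "(\<Union>k. A k) = UNIV"
  proof -
    have "\<exists>k. x \<in> A k" for x
    proof -
      obtain K where K: "\<forall>i\<in>I. norm (F i x) \<le> K"
        using ptw by blast
      obtain k where "K \<le> real k"
        using real_arch_simple by blast
      with K have "x \<in> A k"
        unfolding A_def by (auto intro: order_trans)
      then show ?thesis ..
    qed
    then show ?thesis by auto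
  qed
  have "\<exists>k. interior (A k) \<noteq> {}"
  proof (rule ccontr)
    assume "\<nexists>k. interior (A k) \<noteq> {}"
    then have "Met_TC.mtopology interior_of \<Union>(range A) = {}"
      using closed complete_UNIV
      by (intro Met_TC.metric_Baire_category_alt) auto
    then show False
      using cover by simp
  qed
  then obtain k a e where e: "e > 0" "cball a e \<subseteq> A k"
    by (metis all_not_in_conv mem_interior_cball)
  show ?thesis
  proof (rule that[of "2 * real k / e"])
    fix i x assume i: "i \<in> I"
    interpret bounded_linear "F i" by (rule lin[OF i])
    show "norm (F i x) \<le> 2 * real k / e * norm x"
    proof (cases "x = 0")
      case False
      define u where "u = (e / norm x) *\<^sub>R x"
      have "norm u = e"
        using False e by (simp add: u_def)
      then have "a + u \<in> A k" "a \<in> A k"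
        using e by (auto simp: subset_iff dist_norm)
      then have "norm (F i (a + u)) \<le> real k" "norm (F i a) \<le> real k"
        using i unfolding A_def by auto
      moreover have "F i u = F i (a + u) - F i a"
        by (simp add: add)
      ultimately have "norm (F i u) \<le> 2 * real k"
        using norm_triangle_ineq4[of "F i (a + u)" "F i a"] by simp
      moreover have "norm (F i u) = e / norm x * norm (F i x)"
        using e by (simp add: u_def scaleR)
      ultimately show ?thesis
        using False e by (simp add: field_simps)
    qed (simp add: zero)
  qed (use e in auto)
qed

section \<open>Linear dynamics\<close>

text \<open>At least \<open>N div C\<close> of the values \<open>b k\<close> are at most
  \<open>N\<close>. For \<open>N \<ge> C\<close> rounding down loses at most a factor of two, which
  gives the bound \<open>1 / (2 * C)\<close>.\<close>

lemma lower_density_pos_if_linear_growth: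
  fixes b :: "nat \<Rightarrow> nat"
  assumes b: "strict_mono b" "\<And>k. 1 \<le> b k" "\<And>k. b k \<le> C * (k + 1)" "range b \<subseteq> B"
  shows "lower_density B > 0"
proof -
  have C: "C > 0"
    using b(2,3)[of 0] by auto
  have "1 / (2 * real C) \<le> real (card {n\<in>B. 1 \<le> n \<and> n \<le> N}) / real N" if N: "N \<ge> C" for N
  proof -
    have "b ` {..<N div C} \<subseteq> {n\<in>B. 1 \<le> n \<and> n \<le> N}"
    proof (intro image_subsetI CollectI conjI)
      fix k assume "k \<in> {..<N div C}"
      then have "C * (k + 1) \<le> C * (N div C)"
        by (intro mult_left_mono) auto
      also have "\<dots> \<le> N" by simp
      finally show "b k \<le> N"
        using b(3)[of k] by linarith
    qed (use b in auto)
    then have "card (b ` {..<N div C}) \<le> card {n\<in>B. 1 \<le> n \<and> n \<le> N}"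
      by (intro card_mono) (auto intro: finite_subset[of _ "{..N}"])
    moreover have "card (b ` {..<N div C}) = N div C"
      using strict_mono_imp_inj_on[OF b(1)] by (subst card_image) (auto intro: inj_on_subset)
    ultimately have le: "real (N div C) \<le> real (card {n\<in>B. 1 \<le> n \<and> n \<le> N})"
      by simp
    have "N div C \<ge> 1"
      using N C by (simp add: Suc_leI div_greater_zero_iff)
    then have "C * 1 \<le> C * (N div C)"
      by (intro mult_left_mono) auto
    moreover have "N = C * (N div C) + N mod C" "N mod C < C"
      using C by auto
    ultimately have "N \<le> 2 * C * (N div C)"
      by linarith
    then have "real N \<le> real (2 * C * (N div C))"
      by (rule of_nat_mono)
    then have "1 / (2 * real C) \<le> real (N div C) / real N"
      using C N by (simp add: field_simps)
    also have "\<dots> \<le> real (card {n\<in>B. 1 \<le> n \<and> n \<le> N}) / real N"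
      using le by (intro divide_right_mono) auto
    finally show ?thesis .
  qed
  then have "ereal (1 / (2 * real C)) \<le> lower_density B"
    unfolding lower_density_def
    by (intro Liminf_bounded) (auto simp: eventually_sequentially)
  moreover have "0 < ereal (1 / (2 * real C))"
    using C by simp
  ultimately show ?thesis by (rule less_le_trans[rotated])
qed

section \<open>Implications between the dynamical properties\<close>

lemma infinite_if_upper_density_pos:
  assumes "upper_density B > 0"
  shows "infinite B"
proof
  assume fin: "finite B"
  have "(\<lambda>N. real (card {n\<in>B. 1 \<le> n \<and> n \<le> N}) / real N) \<longlonglongrightarrow> 0"
  proof (rule tendsto_sandwich[of "\<lambda>_. 0" _ _ "\<lambda>N. real (card B) / real N"])
    show "(\<lambda>N. real (card B) / real N) \<longlonglongrightarrow> 0"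
      by real_asymp
    show "\<forall>\<^sub>F N in sequentially. real (card {n\<in>B. 1 \<le> n \<and> n \<le> N}) / real N \<le> real (card B) / real N"
      using fin by (intro always_eventually allI divide_right_mono) (auto intro: card_mono)
  qed auto
  then have "upper_density B = 0"
    unfolding upper_density_def
    by (intro lim_imp_Limsup) (auto simp: zero_ereal_def)
  then show False
    using assms by simp
qed

lemma lower_density_le_upper_density: "lower_density B \<le> upper_density B"
  unfolding lower_density_def upper_density_def by (intro Liminf_le_Limsup) simp

text \<open>The first visit is itself a point of \<open>U\<close> that returns after
  \<open>n - m\<close> steps; the starting point \<open>x\<close> may lie outside
  \<open>U\<close>.\<close>

lemma recurrentI_two_visits:
  fixes S :: "'a::topological_space \<Rightarrow> 'a"
  assumes "\<And>U. open U \<Longrightarrow> U \<noteq> {} \<Longrightarrow> \<exists>x m n. m < n \<and> (S ^^ m) x \<in> U \<and> (S ^^ n) x \<in> U"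
  shows "recurrent S"
  unfolding recurrent_def
proof (intro allI impI)
  fix U :: "'a set" assume "open U \<and> U \<noteq> {}"
  then obtain x m n where v: "m < n" "(S ^^ m) x \<in> U" "(S ^^ n) x \<in> U"
    using assms by blast
  then have "(S ^^ (n - m)) ((S ^^ m) x) = (S ^^ n) x"
    using funpow_add[of "n - m" m S] by simp
  then have "(S ^^ m) x \<in> U \<inter> (S ^^ (n - m)) -` U"
    using v by simp
  then have "U \<inter> (S ^^ (n - m)) -` U \<noteq> {}"
    by (rule ex_in_conv[THEN iffD1, OF exI])
  moreover have "1 \<le> n - m"
    using v by simp
  ultimately show "\<exists>k\<ge>1. U \<inter> (S ^^ k) -` U \<noteq> {}"
    by (intro exI conjI)
qed

lemma recurrent_if_property_A:
  fixes S :: "'a::topological_space \<Rightarrow> 'a"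
  assumes "property_A S"
  shows "recurrent S"
proof (rule recurrentI_two_visits)
  fix U :: "'a set" assume "open U" "U \<noteq> {}"
  then obtain x where "upper_density {n. 1 \<le> n \<and> (S ^^ n) x \<in> U} > 0"
    using assms unfolding property_A_def by blast
  then have inf: "infinite {n. 1 \<le> n \<and> (S ^^ n) x \<in> U}"
    by (rule infinite_if_upper_density_pos)
  then obtain m where "(S ^^ m) x \<in> U"
    using not_finite_existsD by blast
  moreover obtain n where "m < n" "(S ^^ n) x \<in> U"
    using inf unfolding infinite_nat_iff_unbounded by blast
  ultimately show "\<exists>x m n. m < n \<and> (S ^^ m) x \<in> U \<and> (S ^^ n) x \<in> U"
    by blast
qed

lemma property_A_if_frequently_hypercyclic:
  fixes S :: "'a::topological_space \<Rightarrow> 'a"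
  assumes "frequently_hypercyclic S"
  shows "property_A S"
  unfolding property_A_def
proof (intro allI impI)
  fix U :: "'a set" assume "open U \<and> U \<noteq> {}"
  then obtain x where "lower_density {n. 1 \<le> n \<and> (S ^^ n) x \<in> U} > 0"
    using assms unfolding frequently_hypercyclic_def by blast
  then have "upper_density {n. 1 \<le> n \<and> (S ^^ n) x \<in> U} > 0"
    using lower_density_le_upper_density by (rule less_le_trans)
  then show "\<exists>x. upper_density {n. 1 \<le> n \<and> (S ^^ n) x \<in> U} > 0" ..
qed

lemma hypercyclic_if_frequently_hypercyclic:
  fixes S :: "'a::topological_space \<Rightarrow> 'a"
  assumes "frequently_hypercyclic S"
  shows "hypercyclic S"
proof -
  obtain x where x: "\<And>U. open U \<Longrightarrow> U \<noteq> {} \<Longrightarrow> lower_density {n. 1 \<le> n \<and> (S ^^ n) x \<in> U} > 0"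
    using assms unfolding frequently_hypercyclic_def by blast
  have "U \<inter> range (\<lambda>n. (S ^^ n) x) \<noteq> {}" if "open U" "U \<noteq> {}" for U
  proof -
    have "infinite {n. 1 \<le> n \<and> (S ^^ n) x \<in> U}"
      by (rule infinite_if_upper_density_pos[OF less_le_trans[OF x[OF that] lower_density_le_upper_density]])
    then show ?thesis
      using not_finite_existsD by blast
  qed
  then have "- closure (range (\<lambda>n. (S ^^ n) x)) = {}"
    using closure_subset[of "range (\<lambda>n. (S ^^ n) x)"] open_Compl[OF closed_closure] by blast
  then have "closure (range (\<lambda>n. (S ^^ n) x)) = UNIV"
    by blast
  then show ?thesis
    unfolding hypercyclic_def by (intro exI)
qed

lemma recurrent_if_multiply_recurrent:
  fixes S :: "'a::topological_space \<Rightarrow> 'a"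
  assumes "topologically_multiply_recurrent S"
  shows "recurrent S"
  unfolding recurrent_def
proof (intro allI impI)
  fix U :: "'a set" assume "open U \<and> U \<noteq> {}"
  then have "\<exists>k\<ge>1. U \<inter> (\<Inter>j\<in>{1..1}. (S ^^ (j * k)) -` U) \<noteq> {}"
    using assms unfolding topologically_multiply_recurrent_def by blast
  then show "\<exists>k\<ge>1. U \<inter> (S ^^ k) -` U \<noteq> {}"
    by simp
qed

lemma infinite_open_real_normed_vector:
  fixes U :: "'a :: real_normed_vector set"
  assumes "open U" "U \<noteq> {}" and f: "f \<noteq> (0::'a)"
  shows "infinite U"
proof -
  obtain a e where e: "e > 0" "ball a e \<subseteq> U"
    using assms open_contains_ball by blast
  \<comment> \<open>The displacement has norm \<open>e / (n + 2)\<close>; the summand 2 keeps it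
    strictly below \<open>e\<close> already at \<open>n = 0\<close>.\<close>
  define g where "g n = a + (e / (norm f * (real n + 2))) *\<^sub>R f" for n
  have "inj g"
    using f e by (auto simp: inj_on_def g_def field_simps)
  moreover have "g n \<in> U" for n
  proof -
    have "dist a (g n) < e"
      using f e by (simp add: g_def dist_norm divide_less_eq mult_less_cancel_left_pos)
    then show ?thesis
      using e by auto
  qed
  ultimately show ?thesis
    by (meson image_subsetI infinite_super range_inj_infinite)
qed

lemma recurrent_if_hypercyclic:
  fixes S :: "'a :: real_normed_vector \<Rightarrow> 'a"
  assumes "hypercyclic S" and f: "f \<noteq> (0::'a)"
  shows "recurrent S"
proof (rule recurrentI_two_visits)
  fix U :: "'a set" assume U: "open U" "U \<noteq> {}"
  obtain x where x: "closure (range (\<lambda>n. (S ^^ n) x)) = UNIV"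
    using assms unfolding hypercyclic_def by blast
  have visit: "\<exists>n. (S ^^ n) x \<in> V" if "open V" "V \<noteq> {}" for V
    using that x open_Int_closure_eq_empty[of V "range (\<lambda>n. (S ^^ n) x)"] by auto
  obtain m where m: "(S ^^ m) x \<in> U"
    using visit U by blast
  \<comment> \<open>Deleting the orbit up to time \<open>m\<close> forces the next visit to be
    later. A non-zero vector makes \<open>U\<close> infinite, so something remains.\<close>
  define V where "V = U - (\<lambda>n. (S ^^ n) x) ` {..m}"
  have "open V"
    unfolding V_def using U by (intro open_Diff finite_imp_closed) auto
  moreover have "V \<noteq> {}"
    unfolding V_def using infinite_open_real_normed_vector[OF U f]
    by (metis Diff_eq_empty_iff finite_atMost finite_imageI finite_subset)
  ultimately obtain n where n: "(S ^^ n) x \<in> V"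
    using visit by blast
  then have "m < n"
    unfolding V_def by (meson DiffD2 atMost_iff imageI linorder_not_less)
  then show "\<exists>x m n. m < n \<and> (S ^^ m) x \<in> U \<and> (S ^^ n) x \<in> U"
    using m n V_def by blast
qed

text \<open>The second clause is the Cauchy criterion for absolute summability over the integers.
  \<open>T\<close> need not be invertible: the points with negative index are a chosen chain of
  preimages.\<close>

definition summable_orbit :: "('a::real_normed_vector \<Rightarrow> 'a) \<Rightarrow> (int \<Rightarrow> 'a) \<Rightarrow> bool" where
  "summable_orbit T y \<longleftrightarrow> (\<forall>m. T (y m) = y (m + 1)) \<and>
     (\<forall>e>0. \<exists>N::nat. \<forall>F. finite F \<longrightarrow> (\<forall>m\<in>F. int N \<le> \<bar>m\<bar>) \<longrightarrow> (\<Sum>m\<in>F. norm (y m)) \<le> e)"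

lemma summable_orbit_funpow:
  assumes "summable_orbit T y"
  shows "(T ^^ n) (y m) = y (m + int n)"
  using assms by (induction n arbitrary: m) (auto simp: summable_orbit_def algebra_simps)

lemma summable_orbit_tail:
  assumes "summable_orbit T y" "e > 0"
  obtains N :: nat where "\<And>F. finite F \<Longrightarrow> (\<And>m. m \<in> F \<Longrightarrow> int N \<le> \<bar>m\<bar>) \<Longrightarrow> (\<Sum>m\<in>F. norm (y m)) \<le> e"
  using assms unfolding summable_orbit_def by meson

lemma bounded_linear_funpow:
  assumes "bounded_linear (T :: 'a::real_normed_vector \<Rightarrow> 'a)"
  shows "bounded_linear (T ^^ n)"
proof (induction n)
  case 0
  then show ?case by (simp add: id_def bounded_linear_ident)
next
  case (Suc n)
  then show ?case
    using bounded_linear_compose[OF assms] by (simp add: o_def)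
qed

lemma summable_orbit_add:
  assumes T: "bounded_linear T" and y: "summable_orbit T y" and z: "summable_orbit T z"
  shows "summable_orbit T (\<lambda>m. y m + z m)"
  unfolding summable_orbit_def
proof (intro conjI allI impI)
  fix m show "T (y m + z m) = y (m + 1) + z (m + 1)"
    using y z by (simp add: linear_add[OF bounded_linear.linear[OF T]] summable_orbit_def)
next
  fix e :: real assume "e > 0"
  then have e: "e / 2 > 0" by simp
  obtain M where M: "\<And>F. finite F \<Longrightarrow> (\<And>m. m \<in> F \<Longrightarrow> int M \<le> \<bar>m\<bar>) \<Longrightarrow> (\<Sum>m\<in>F. norm (y m)) \<le> e / 2"
    using summable_orbit_tail[OF y e] by blast
  obtain N where N: "\<And>F. finite F \<Longrightarrow> (\<And>m. m \<in> F \<Longrightarrow> int N \<le> \<bar>m\<bar>) \<Longrightarrow> (\<Sum>m\<in>F. norm (z m)) \<le> e / 2"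
    using summable_orbit_tail[OF z e] by blast
  have "(\<Sum>m\<in>F. norm (y m + z m)) \<le> e" if "finite F" "\<forall>m\<in>F. int (max M N) \<le> \<bar>m\<bar>" for F
  proof -
    have "(\<Sum>m\<in>F. norm (y m + z m)) \<le> (\<Sum>m\<in>F. norm (y m) + norm (z m))"
      by (intro sum_mono norm_triangle_ineq)
    also have "\<dots> \<le> e / 2 + e / 2"
      unfolding sum.distrib using that by (intro add_mono M N) force+
    finally show ?thesis by simp
  qed
  then show "\<exists>N::nat. \<forall>F. finite F \<longrightarrow> (\<forall>m\<in>F. int N \<le> \<bar>m\<bar>) \<longrightarrow> (\<Sum>m\<in>F. norm (y m + z m)) \<le> e"
    by blast
qed

lemma summable_orbit_zero: "bounded_linear T \<Longrightarrow> summable_orbit T (\<lambda>_. 0)"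
  by (simp add: summable_orbit_def linear_0 bounded_linear.linear)

lemma summable_orbit_scaleC:
  assumes T: "complex_homogeneous T" and y: "summable_orbit T (y :: int \<Rightarrow> 'a :: complex_inner)"
  shows "summable_orbit T (\<lambda>m. c *\<^sub>C y m)"
  unfolding summable_orbit_def
proof (intro conjI allI impI)
  fix m show "T (c *\<^sub>C y m) = c *\<^sub>C y (m + 1)"
    using y T by (simp add: complex_homogeneous_def summable_orbit_def)
next
  fix e :: real assume "e > 0"
  \<comment> \<open>The summand 1 avoids a separate case \<open>c = 0\<close>.\<close>
  then have e: "e / (cmod c + 1) > 0"
    by (simp add: add_nonneg_pos)
  obtain N where N: "\<And>F. finite F \<Longrightarrow> (\<And>m. m \<in> F \<Longrightarrow> int N \<le> \<bar>m\<bar>) \<Longrightarrow> (\<Sum>m\<in>F. norm (y m)) \<le> e / (cmod c + 1)"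
    using summable_orbit_tail[OF y e] by blast
  have "(\<Sum>m\<in>F. norm (c *\<^sub>C y m)) \<le> e" if "finite F" "\<forall>m\<in>F. int N \<le> \<bar>m\<bar>" for F
  proof -
    have "(\<Sum>m\<in>F. norm (c *\<^sub>C y m)) = cmod c * (\<Sum>m\<in>F. norm (y m))"
      by (simp add: norm_scaleC sum_distrib_left)
    also have "\<dots> \<le> (cmod c + 1) * (e / (cmod c + 1))"
      using that e by (intro mult_mono N) (auto intro: sum_nonneg)
    also have "\<dots> = e"
      using norm_ge_zero[of c] by (simp add: add_nonneg_eq_0_iff)
    finally show ?thesis .
  qed
  then show "\<exists>N::nat. \<forall>F. finite F \<longrightarrow> (\<forall>m\<in>F. int N \<le> \<bar>m\<bar>) \<longrightarrow> (\<Sum>m\<in>F. norm (c *\<^sub>C y m)) \<le> e"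
    by blast
qed

text \<open>The witness \<open>\<Sum>i\<le>m. y (- i k)\<close> returns near \<open>y 0\<close> at all times \<open>0, k, \<dots>, m k\<close>, because
  time \<open>j k\<close> moves the \<open>j\<close>-th summand to \<open>y 0\<close> and the others far away along the orbit.\<close>

theorem multiply_recurrent_if_summable_orbits_dense:
  fixes T :: "'a :: real_normed_vector \<Rightarrow> 'a"
  assumes T: "bounded_linear T" and dense: "closure {y 0 |y. summable_orbit T y} = UNIV"
  shows "topologically_multiply_recurrent T"
  unfolding topologically_multiply_recurrent_def
proof (intro allI impI)
  fix U :: "'a set" and m :: nat
  assume U: "open U \<and> U \<noteq> {}"
  then have "U \<inter> {y 0 |y. summable_orbit T y} \<noteq> {}"
    using dense open_Int_closure_eq_empty[of U "{y 0 |y. summable_orbit T y}"] by auto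
  then obtain y where y: "summable_orbit T y" "y 0 \<in> U"
    by blast
  then obtain e where e: "e > 0" "ball (y 0) e \<subseteq> U"
    using U open_contains_ball by blast
  obtain N where N: "\<And>F. finite F \<Longrightarrow> (\<And>m. m \<in> F \<Longrightarrow> int N \<le> \<bar>m\<bar>) \<Longrightarrow> (\<Sum>m\<in>F. norm (y m)) \<le> e / 2"
    using summable_orbit_tail[OF y(1), of "e / 2"] e by auto
  \<comment> \<open>Distinct multiples of \<open>k\<close> differ by at least \<open>N\<close>; the
    1 is there because a return time must be positive.\<close>
  define k where "k = max N 1"
  define v where "v = (\<Sum>i\<le>m. y (- int (i * k)))"
  have "(T ^^ (j * k)) v \<in> U" if j: "j \<le> m" for j
  proof -
    interpret Tn: bounded_linear "T ^^ (j * k)"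
      by (rule bounded_linear_funpow[OF T])
    let ?t = "\<lambda>i. (int j - int i) * int k"
    have "(T ^^ (j * k)) v = (\<Sum>i\<le>m. y (?t i))"
      unfolding v_def Tn.sum
      by (simp add: summable_orbit_funpow[OF y(1)] algebra_simps)
    also have "\<dots> = y 0 + (\<Sum>i\<in>{..m} - {j}. y (?t i))"
      using j by (subst sum.remove[of _ j]) auto
    finally have "norm ((T ^^ (j * k)) v - y 0) \<le> (\<Sum>i\<in>{..m} - {j}. norm (y (?t i)))"
      by (simp add: norm_sum)
    also have "\<dots> = (\<Sum>n\<in>?t ` ({..m} - {j}). norm (y n))"
      by (subst sum.reindex) (auto simp: inj_on_def k_def)
    also have "\<dots> \<le> e / 2"
    proof (rule N)
      fix n assume "n \<in> ?t ` ({..m} - {j})"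
      then obtain i where i: "i \<noteq> j" "n = ?t i"
        by auto
      then have "1 * int k \<le> \<bar>int j - int i\<bar> * int k"
        by (intro mult_right_mono) auto
      then show "int N \<le> \<bar>n\<bar>"
        using i by (simp add: abs_mult k_def)
    qed auto
    finally show ?thesis
      using e by (auto simp: subset_iff dist_norm norm_minus_commute)
  qed
  note visits = this
  have "v \<in> U"
    using visits[of 0] by simp
  moreover have "v \<in> (\<Inter>j\<in>{1..m}. (T ^^ (j * k)) -` U)"
    using visits by auto
  moreover have "k \<ge> 1"
    by (simp add: k_def)
  ultimately show "\<exists>k\<ge>1. U \<inter> (\<Inter>j\<in>{1..m}. (T ^^ (j * k)) -` U) \<noteq> {}"
    by blast
qed

subsection \<open>Well separated sets of positive lower density\<close>

text \<open>Here \<open>val2 0 = 0\<close>.\<close>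

definition val2 :: "nat \<Rightarrow> nat" where
  "val2 i = multiplicity 2 i"

lemma val2_odd: "odd i \<Longrightarrow> val2 i = 0"
  by (simp add: val2_def not_dvd_imp_multiplicity_0)

lemma val2_double: "i > 0 \<Longrightarrow> val2 (2 * i) = Suc (val2 i)"
  unfolding val2_def by (subst multiplicity_times_same) auto

lemma val2_power_times_odd: "val2 (2 ^ a * (2 * k + 1)) = a"
proof (induction a)
  case 0
  show ?case by (simp add: val2_odd)
next
  case (Suc a)
  have "val2 (2 ^ Suc a * (2 * k + 1)) = val2 (2 * (2 ^ a * (2 * k + 1)))"
    by (simp add: mult.assoc)
  also have "\<dots> = Suc a"
    using val2_double[of "2 ^ a * (2 * k + 1)"] Suc by simp
  finally show ?case .
qed

lemma sum_val2_double: "(\<Sum>i\<le>2 * n. val2 i) = n + (\<Sum>i\<le>n. val2 i)"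
proof (induction n)
  case 0
  show ?case by (simp add: val2_def)
next
  case (Suc n)
  have "(\<Sum>i\<le>2 * Suc n. val2 i) = (\<Sum>i\<le>2 * n. val2 i) + val2 (2 * n + 1) + val2 (2 * Suc n)"
    by simp
  also have "val2 (2 * n + 1) = 0"
    by (rule val2_odd) simp
  also have "val2 (2 * Suc n) = Suc (val2 (Suc n))"
    by (rule val2_double) simp
  finally show ?case
    using Suc by simp
qed

text \<open>The sum is the exponent of 2 in the factorial of \<open>n\<close>. Only even indices
  contribute, so halving the range drives the induction.\<close>

lemma sum_val2_le: "(\<Sum>i\<le>n. val2 i) \<le> n"
proof (induction n rule: less_induct)
  case (less n)
  show ?case
  proof (cases "n = 0")
    case True
    then show ?thesis by (simp add: val2_def)
  next
    case False
    define h where "h = n div 2"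
    have "h < n" using False by (simp add: h_def)
    then have IH: "(\<Sum>i\<le>h. val2 i) \<le> h" by (rule less)
    have "(\<Sum>i\<le>n. val2 i) = (\<Sum>i\<le>2 * h. val2 i)"
    proof (cases "even n")
      case False
      then have "n = Suc (2 * h)" by (simp add: h_def)
      moreover have "val2 (Suc (2 * h)) = 0" by (rule val2_odd) simp
      ultimately show ?thesis by simp
    qed (simp add: h_def)
    then show ?thesis
      using IH sum_val2_double[of h] by (simp add: h_def)
  qed
qed

text \<open>The sum up to and including \<open>j\<close> reserves a gap of \<open>val2 j\<close>
  before position \<open>j\<close>; the sum strictly below \<open>j\<close> reserves
  \<open>val2 i\<close> after each earlier position \<open>i\<close>; the summand \<open>j\<close>
  makes the gaps strict. As \<open>val2\<close> has average at most 1, the growth stays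
  linear.\<close>

definition spread :: "nat \<Rightarrow> nat" where
  "spread j = (\<Sum>i\<le>j. val2 i) + (\<Sum>i<j. val2 i) + j"

lemma spread_gap:
  assumes "i < j"
  shows "spread i + max (val2 i) (val2 j) < spread j"
proof -
  have "(\<Sum>l\<le>i. val2 l) + val2 j = (\<Sum>l\<in>insert j {..i}. val2 l)"
    using assms by simp
  also have "\<dots> \<le> (\<Sum>l\<le>j. val2 l)"
    using assms by (intro sum_mono2) auto
  finally have 1: "(\<Sum>l\<le>i. val2 l) + val2 j \<le> (\<Sum>l\<le>j. val2 l)" .
  have "(\<Sum>l<i. val2 l) + val2 i = (\<Sum>l\<in>insert i {..<i}. val2 l)"
    by simp
  also have "\<dots> \<le> (\<Sum>l<j. val2 l)"
    using assms by (intro sum_mono2) auto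
  finally show ?thesis
    using 1 assms unfolding spread_def by simp
qed

lemma strict_mono_spread: "strict_mono spread"
  by (rule strict_monoI) (use spread_gap in force)

lemma spread_le: "spread j \<le> 3 * j"
proof -
  have "(\<Sum>i<j. val2 i) \<le> (\<Sum>i\<le>j. val2 i)"
    by (intro sum_mono2) auto
  then show ?thesis
    using sum_val2_le[of j] unfolding spread_def by linarith
qed

lemma spread_separated:
  assumes "i \<noteq> j"
  shows "int (max (val2 i) (val2 j)) \<le> \<bar>int (spread i) - int (spread j)\<bar>"
  using spread_gap[of i j] spread_gap[of j i] assms by (cases "i < j") auto

text \<open>Every vector \<open>y p 0\<close> of a dense sequence is visited, up to an error \<open>2 (1/2)\<^sup>p\<close>, at the times
  \<open>spread j\<close> with \<open>val2 j = N p\<close>, for a fast increasing sequence \<open>N\<close>. The sum over all \<open>j\<close> of the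
  orbit points \<open>y p (- spread j)\<close> does this, since the gaps of \<open>spread\<close> keep the
  other summands far away along their orbits.\<close>

theorem frequently_hypercyclic_if_summable_orbits_dense:
  fixes T :: "'a :: banach \<Rightarrow> 'a"
  assumes T: "bounded_linear T" and orb: "\<And>i::nat. summable_orbit T (z i)"
    and dense: "closure (range (\<lambda>i. z i 0)) = UNIV"
  shows "frequently_hypercyclic T"
proof -
  \<comment> \<open>Each orbit \<open>z l\<close> is listed infinitely often, so that it occurs with
    arbitrarily small prescribed error.\<close>
  define y where "y p = z (fst (prod_decode p))" for p
  have y: "summable_orbit T (y p)" for p
    unfolding y_def by (rule orb)
  \<comment> \<open>One threshold serves all \<open>p \<le> q\<close>. The factor
    \<open>(1/2) ^ p\<close> makes the bounds summable over the orbits, and \<open>(1/2) ^ q\<close>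
    is the accuracy wanted at visits to \<open>y q 0\<close>.\<close>
  have "\<exists>M::nat. \<forall>p\<le>q. \<forall>F. finite F \<longrightarrow> (\<forall>m\<in>F. int M \<le> \<bar>m\<bar>) \<longrightarrow>
          (\<Sum>m\<in>F. norm (y p m)) \<le> (1/2) ^ p * (1/2) ^ q" for q
  proof -
    have "\<exists>M::nat. \<forall>F. finite F \<longrightarrow> (\<forall>m\<in>F. int M \<le> \<bar>m\<bar>) \<longrightarrow>
          (\<Sum>m\<in>F. norm (y p m)) \<le> (1/2) ^ p * (1/2) ^ q" for p
      by (rule summable_orbit_tail[OF y, of "(1/2) ^ p * (1/2) ^ q" p]) (simp, blast)
    then obtain M :: "nat \<Rightarrow> nat" where
      M: "\<And>p F. finite F \<Longrightarrow> (\<forall>m\<in>F. int (M p) \<le> \<bar>m\<bar>) \<Longrightarrow> (\<Sum>m\<in>F. norm (y p m)) \<le> (1/2) ^ p * (1/2) ^ q"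
      by metis
    have M_le: "int (M p) \<le> int (Max (M ` {..q}))" if "p \<le> q" for p
      using that by auto
    show ?thesis
    proof (intro exI[of _ "Max (M ` {..q})"] allI impI)
      fix p F
      assume a: "p \<le> q" "finite F" "\<forall>m\<in>F. int (Max (M ` {..q})) \<le> \<bar>m\<bar>"
      have "\<forall>m\<in>F. int (M p) \<le> \<bar>m\<bar>"
        using a(3) M_le[OF a(1)] by (blast intro: order_trans)
      then show "(\<Sum>m\<in>F. norm (y p m)) \<le> (1/2) ^ p * (1/2) ^ q"
        by (intro M a(2))
    qed
  qed
  then obtain M :: "nat \<Rightarrow> nat" where
    M: "\<And>p q F. p \<le> q \<Longrightarrow> finite F \<Longrightarrow> (\<forall>m\<in>F. int (M q) \<le> \<bar>m\<bar>) \<Longrightarrow>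
          (\<Sum>m\<in>F. norm (y p m)) \<le> (1/2) ^ p * (1/2) ^ q"
    by metis
  \<comment> \<open>Dominates \<open>M\<close> and is strictly increasing, so a value of
    \<open>val2\<close> determines the orbit it belongs to.\<close>
  define N where "N q = (\<Sum>i\<le>q. M i) + q" for q
  have "strict_mono N"
    by (rule strict_monoI_Suc) (simp add: N_def)
  then have N_inj: "N p = N q \<longleftrightarrow> p = q" for p q
    by (simp add: strict_mono_eq)
  have M_le: "int (M q) \<le> int (N q)" for q
    using member_le_sum[of q "{..q}" M] by (auto simp: N_def simp del: of_nat_sum)
  have N: "(\<Sum>m\<in>F. norm (y p m)) \<le> (1/2) ^ p * (1/2) ^ q"
    if "p \<le> q" "finite F" "\<And>m. m \<in> F \<Longrightarrow> int (N q) \<le> \<bar>m\<bar>" for p q F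
    using that(3) M_le[of q] by (intro M that(1,2)) (blast intro: order_trans)
  \<comment> \<open>Positions whose \<open>val2\<close> is not of the form \<open>N p\<close> carry
    the zero orbit.\<close>
  define Z where "Z j = (if val2 j \<in> range N then y (inv N (val2 j)) else (\<lambda>_. 0))" for j
  have Z: "Z j = y p" if "val2 j = N p" for j p
    using that \<open>strict_mono N\<close> by (simp add: Z_def strict_mono_imp_inj_on)
  have TZ: "(T ^^ n) (Z j m) = Z j (m + int n)" for n j m
    using summable_orbit_funpow[OF y] linear_0[OF bounded_linear.linear[OF bounded_linear_funpow[OF T]]]
    by (simp add: Z_def)
  \<comment> \<open>Group the positions by their orbit \<open>p\<close>. Since
    \<open>val2 j = N p\<close>, the indices have absolute value at least both \<open>N p\<close>
    and \<open>N q\<close>; using the threshold for the larger of \<open>p\<close> and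
    \<open>q\<close>, orbit \<open>p\<close> contributes at most
    \<open>(1/2) ^ p * (1/2) ^ q\<close>. The geometric series gives the factor 2.\<close>
  have Z_sum: "(\<Sum>j\<in>J. norm (Z j (t - int (spread j)))) \<le> 2 * (1/2) ^ q"
    if J: "finite J" "\<And>j. j \<in> J \<Longrightarrow> int (max (val2 j) (N q)) \<le> \<bar>t - int (spread j)\<bar>" for J t q
  proof -
    define J' where "J' = {j\<in>J. val2 j \<in> range N}"
    define g where "g j = inv N (val2 j)" for j
    have fin: "finite J'"
      using J unfolding J'_def by simp
    have g: "N (g j) = val2 j" if "j \<in> J'" for j
      using that unfolding J'_def g_def by (auto simp: f_inv_into_f)
    have inner: "(\<Sum>j\<in>{j\<in>J'. g j = p}. norm (Z j (t - int (spread j)))) \<le> (1/2) ^ p * (1/2) ^ q" for p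
    proof -
      let ?Jp = "{j\<in>J'. g j = p}"
      have "(\<Sum>j\<in>?Jp. norm (Z j (t - int (spread j)))) = (\<Sum>j\<in>?Jp. norm (y p (t - int (spread j))))"
        using g Z by (intro sum.cong) (auto, metis)
      also have "\<dots> = (\<Sum>m\<in>(\<lambda>j. t - int (spread j)) ` ?Jp. norm (y p m))"
        by (subst sum.reindex) (auto simp: inj_on_def strict_mono_eq[OF strict_mono_spread])
      also have "\<dots> \<le> (1/2) ^ p * (1/2) ^ q"
      proof -
        have far: "int (N p) \<le> \<bar>m\<bar>" "int (N q) \<le> \<bar>m\<bar>" if m: "m \<in> (\<lambda>j. t - int (spread j)) ` ?Jp" for m
        proof -
          obtain j where j: "j \<in> ?Jp" "m = t - int (spread j)"
            using m by blast
          then have "val2 j = N p" "j \<in> J"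
            using g[of j] by (auto simp: J'_def)
          then have "int (max (N p) (N q)) \<le> \<bar>m\<bar>"
            using J(2)[of j] j(2) by simp
          then show "int (N p) \<le> \<bar>m\<bar>" "int (N q) \<le> \<bar>m\<bar>"
            unfolding of_nat_max by linarith+
        qed
        have fin_im: "finite ((\<lambda>j. t - int (spread j)) ` ?Jp)"
          using fin by simp
        show ?thesis
        proof (cases "p \<le> q")
          case True
          then show ?thesis
            using fin_im far(2) by (intro N) auto
        next
          case False
          have "(\<Sum>m\<in>(\<lambda>j. t - int (spread j)) ` ?Jp. norm (y p m)) \<le> (1/2) ^ p * (1/2) ^ p"
            using fin_im far(1) by (intro N) auto
          also have "\<dots> \<le> (1/2) ^ p * (1/2) ^ q"
            using False by (intro mult_left_mono power_decreasing) auto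
          finally show ?thesis .
        qed
      qed
      finally show ?thesis .
    qed
    have "(\<Sum>j\<in>J. norm (Z j (t - int (spread j)))) = (\<Sum>j\<in>J'. norm (Z j (t - int (spread j))))"
      using J(1) by (intro sum.mono_neutral_right) (auto simp: J'_def Z_def)
    also have "\<dots> = (\<Sum>p\<in>g ` J'. \<Sum>j\<in>{j\<in>J'. g j = p}. norm (Z j (t - int (spread j))))"
      using fin by (rule sum.image_gen)
    also have "\<dots> \<le> (\<Sum>p\<in>g ` J'. (1/2) ^ p * (1/2) ^ q)"
      by (intro sum_mono inner)
    also have "\<dots> = (\<Sum>p\<in>g ` J'. (1/2) ^ p) * (1/2 :: real) ^ q"
      by (simp add: sum_distrib_right)
    also have "\<dots> \<le> 2 * (1/2) ^ q"
    proof (rule mult_right_mono)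
      have "(\<Sum>p\<in>g ` J'. (1/2 :: real) ^ p) \<le> (\<Sum>p. (1/2) ^ p)"
        using fin by (intro sum_le_suminf) auto
      then show "(\<Sum>p\<in>g ` J'. (1/2 :: real) ^ p) \<le> 2"
        by (simp add: suminf_geometric)
    qed simp
    finally show ?thesis .
  qed
  define w where "w j = Z j (- int (spread j))" for j
  have spread_ge: "val2 j \<le> spread j" "j \<le> spread j" for j
    using member_le_sum[of j "{..j}" val2] by (auto simp: spread_def)
  have "summable (\<lambda>j. norm (w j))"
  proof (rule bounded_imp_summable)
    \<comment> \<open>From \<open>j = N 0\<close> on, \<open>spread j\<close> is at least
      \<open>N 0\<close> and \<open>val2 j\<close>, so \<open>Z_sum\<close> applies with
      \<open>t = 0\<close> and \<open>q = 0\<close> and contributes the constant 2.\<close>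
    show "(\<Sum>j\<le>n. norm (w j)) \<le> (\<Sum>j<N 0. norm (w j)) + 2" for n
    proof -
      have "(\<Sum>j\<in>{..n} - {..<N 0}. norm (Z j (0 - int (spread j)))) \<le> 2 * (1/2) ^ 0"
      proof (rule Z_sum)
        show "int (max (val2 j) (N 0)) \<le> \<bar>0 - int (spread j)\<bar>" if "j \<in> {..n} - {..<N 0}" for j
          using that spread_ge[of j] by auto
      qed simp
      moreover have "(\<Sum>j\<le>n. norm (w j)) \<le> (\<Sum>j\<in>{..<N 0} \<union> ({..n} - {..<N 0}). norm (w j))"
        by (intro sum_mono2) auto
      ultimately show ?thesis
        by (subst (asm) sum.union_disjoint) (auto simp: w_def)
    qed
  qed simp
  then have w: "summable w"
    by (rule summable_norm_cancel)
  define x where "x = suminf w"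
  \<comment> \<open>At time \<open>spread i\<close> summand \<open>i\<close> sits exactly at
    \<open>y q 0\<close>. By \<open>spread_separated\<close> every other summand \<open>j\<close> is
    at an index of absolute value at least \<open>max (val2 j) (N q)\<close>.\<close>
  have visit: "norm ((T ^^ spread i) x - y q 0) \<le> 2 * (1/2) ^ q" if i: "val2 i = N q" for i q
  proof -
    interpret Tn: bounded_linear "T ^^ spread i"
      by (rule bounded_linear_funpow[OF T])
    let ?h = "\<lambda>j. Z j (int (spread i) - int (spread j))"
    have "(\<lambda>j. (T ^^ spread i) (w j)) sums (T ^^ spread i) x"
      unfolding x_def by (rule Tn.sums[OF summable_sums[OF w]])
    then have "?h sums (T ^^ spread i) x"
      by (simp add: w_def TZ)
    then have "(\<lambda>n. norm ((\<Sum>j<n. ?h j) - y q 0)) \<longlonglongrightarrow> norm ((T ^^ spread i) x - y q 0)"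
      unfolding sums_def by (intro tendsto_intros)
    moreover have "norm ((\<Sum>j<n. ?h j) - y q 0) \<le> 2 * (1/2) ^ q" if n: "n > i" for n
    proof -
      have "(\<Sum>j<n. ?h j) = y q 0 + (\<Sum>j\<in>{..<n} - {i}. ?h j)"
        using n i by (subst sum.remove[of _ i]) (auto simp: Z)
      then have "norm ((\<Sum>j<n. ?h j) - y q 0) \<le> (\<Sum>j\<in>{..<n} - {i}. norm (?h j))"
        by (simp add: norm_sum)
      also have "\<dots> \<le> 2 * (1/2) ^ q"
      proof (rule Z_sum)
        show "int (max (val2 j) (N q)) \<le> \<bar>int (spread i) - int (spread j)\<bar>" if "j \<in> {..<n} - {i}" for j
          using spread_separated[of i j] that i by (simp add: max.commute)
      qed simp
      finally show ?thesis .
    qed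
    ultimately show ?thesis
      by (intro LIMSEQ_le_const2) (auto intro!: exI[of _ "Suc i"])
  qed
  show ?thesis
    unfolding frequently_hypercyclic_def
  proof (intro exI[of _ x] allI impI)
    fix U :: "'a set" assume U: "open U \<and> U \<noteq> {}"
    then have "U \<inter> range (\<lambda>i. z i 0) \<noteq> {}"
      using dense open_Int_closure_eq_empty[of U "range (\<lambda>i. z i 0)"] by auto
    then obtain l where "z l 0 \<in> U"
      by blast
    then obtain e where e: "e > 0" "ball (z l 0) e \<subseteq> U"
      using U open_contains_ball by blast
    have "e / 2 > 0"
      using e by simp
    then obtain r where r: "(1/2 :: real) ^ r < e / 2"
      using real_arch_pow_inv[of "e / 2" "1/2"] by auto
    \<comment> \<open>The first component selects the orbit \<open>z l\<close>; the second forces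
      \<open>q \<ge> r\<close>, which makes the error smaller than \<open>e\<close>.\<close>
    define q where "q = prod_encode (l, r)"
    have yq: "y q = z l"
      by (simp add: y_def q_def)
    have "r \<le> q"
      unfolding q_def by (rule le_prod_encode_2)
    then have "(1/2 :: real) ^ q \<le> (1/2) ^ r"
      by (intro power_decreasing) auto
    then have small: "2 * (1/2 :: real) ^ q < e"
      using r by linarith
    \<comment> \<open>The arguments \<open>2 ^ N q * (2 * k + 1)\<close> are exactly the positive
      integers with \<open>val2\<close> equal to \<open>N q\<close>; they form an arithmetic
      progression, and \<open>spread\<close> keeps its growth linear.\<close>
    define b where "b k = spread (2 ^ N q * (2 * k + 1))" for k
    show "lower_density {n. 1 \<le> n \<and> (T ^^ n) x \<in> U} > 0"
    proof (rule lower_density_pos_if_linear_growth)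
      show "strict_mono b"
        by (intro strict_monoI) (simp add: b_def strict_mono_less[OF strict_mono_spread])
      show ge: "1 \<le> b k" for k
      proof -
        have "1 \<le> 2 ^ N q * (2 * k + 1)"
          by (simp only: One_nat_def Suc_le_eq) simp
        also have "\<dots> \<le> b k"
          unfolding b_def by (rule spread_ge)
        finally show ?thesis .
      qed
      show "b k \<le> (6 * 2 ^ N q) * (k + 1)" for k
      proof -
        have "b k \<le> 3 * (2 ^ N q * (2 * k + 1))"
          unfolding b_def by (rule spread_le)
        also have "\<dots> \<le> 3 * (2 ^ N q * (2 * (k + 1)))"
          by (intro mult_left_mono) auto
        also have "\<dots> = (6 * 2 ^ N q) * (k + 1)" by simp
        finally show ?thesis .
      qed
      show "range b \<subseteq> {n. 1 \<le> n \<and> (T ^^ n) x \<in> U}"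
      proof safe
        fix k
        show "1 \<le> b k" by (rule ge)
        have "norm ((T ^^ b k) x - z l 0) \<le> 2 * (1/2) ^ q"
          unfolding b_def yq[symmetric] by (intro visit val2_power_times_odd)
        then show "(T ^^ b k) x \<in> U"
          using e small by (auto simp: subset_iff dist_norm norm_minus_commute)
      qed
    qed
  qed
qed

section \<open>Oscillating integrals over arcs of the unit circle\<close>

text \<open>The product rule for \<open>exp (c * t) * H t\<close>, whose boundary values vanish.
  Keeping the factor \<open>c\<close> on the left instead of dividing by it covers
  \<open>c = 0\<close>.\<close>

lemma integral_by_parts_exp:
  assumes ab: "a \<le> b" and H: "H holomorphic_on W" "open W" "complex_of_real ` {a..b} \<subseteq> W"
    and zero: "H (of_real a) = 0" "H (of_real b) = 0"
  shows "c * integral {a..b} (\<lambda>t. exp (c * of_real t) * H (of_real t))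
           = - integral {a..b} (\<lambda>t. exp (c * of_real t) * deriv H (of_real t))"
proof -
  have cont: "continuous_on {a..b} (\<lambda>t. H (complex_of_real t))"
    "continuous_on {a..b} (\<lambda>t. deriv H (complex_of_real t))"
    using holomorphic_on_imp_continuous_on[OF H(1)]
      holomorphic_on_imp_continuous_on[OF holomorphic_deriv[OF H(1,2)]] H(3)
    by (auto intro!: continuous_on_compose2[where g = H and t = W]
        continuous_on_compose2[where g = "deriv H" and t = W] continuous_intros)
  have "((\<lambda>t. exp (c * of_real t) * H (of_real t)) has_vector_derivative
          c * (exp (c * of_real t) * H (of_real t)) + exp (c * of_real t) * deriv H (of_real t))
          (at t within {a..b})"
    if "t \<in> {a..b}" for t
  proof -
    have "(H has_field_derivative deriv H (of_real t)) (at (of_real t))"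
      using H that by (intro holomorphic_derivI[OF H(1,2)]) auto
    then have "((\<lambda>z. exp (c * z) * H z) has_field_derivative
        c * (exp (c * of_real t) * H (of_real t)) + exp (c * of_real t) * deriv H (of_real t))
        (at (of_real t))"
      by (auto intro!: derivative_eq_intros simp: algebra_simps)
    then show ?thesis
      by (rule has_vector_derivative_real_field)
  qed
  from fundamental_theorem_of_calculus[OF ab this]
  have "((\<lambda>t. c * (exp (c * of_real t) * H (of_real t)) + exp (c * of_real t) * deriv H (of_real t))
          has_integral 0) {a..b}"
    using zero by simp
  then have "0 = integral {a..b} (\<lambda>t. c * (exp (c * of_real t) * H (of_real t))
                    + exp (c * of_real t) * deriv H (of_real t))"
    by (simp add: integral_unique)
  also have "\<dots> = c * integral {a..b} (\<lambda>t. exp (c * of_real t) * H (of_real t))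
              + integral {a..b} (\<lambda>t. exp (c * of_real t) * deriv H (of_real t))"
    by (subst integral_add) (auto intro!: integrable_continuous_interval continuous_intros cont)
  finally show ?thesis
    by (simp add: eq_neg_iff_add_eq_0)
qed

text \<open>Two integrations by parts move both factors \<open>n\<close> onto the second derivative
  of \<open>H\<close>, which is bounded on the compact interval.\<close>

lemma oscillatory_integral_decay:
  assumes ab: "a \<le> b" and H: "H holomorphic_on W" "open W" "complex_of_real ` {a..b} \<subseteq> W"
    and zero: "H (of_real a) = 0" "H (of_real b) = 0"
      "deriv H (of_real a) = 0" "deriv H (of_real b) = 0"
  obtains C where
    "\<And>n::int. (real_of_int n)\<^sup>2 * cmod (integral {a..b} (\<lambda>t. exp (\<i> * of_int n * of_real t) * H (of_real t))) \<le> C"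
proof -
  note H' = holomorphic_deriv[OF H(1,2)]
  note H'' = holomorphic_deriv[OF H' H(2)]
  have cont: "continuous_on {a..b} (\<lambda>t. deriv (deriv H) (complex_of_real t))"
    using holomorphic_on_imp_continuous_on[OF H''] H(3)
    by (auto intro!: continuous_on_compose2[where g = "deriv (deriv H)" and t = W] continuous_intros)
  then have "bounded ((\<lambda>t. deriv (deriv H) (complex_of_real t)) ` {a..b})"
    by (intro compact_imp_bounded compact_continuous_image) auto
  then obtain B where B: "\<And>t. t \<in> {a..b} \<Longrightarrow> cmod (deriv (deriv H) (of_real t)) \<le> B"
    unfolding bounded_iff by (metis imageI)
  show ?thesis
  proof (rule that[of "B * (b - a)"])
    fix n :: int
    define c where "c = \<i> * complex_of_int n"
    define I where "I = integral {a..b} (\<lambda>t. exp (c * of_real t) * H (of_real t))"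
    define J where "J = integral {a..b} (\<lambda>t. exp (c * of_real t) * deriv (deriv H) (of_real t))"
    have "c * (c * I) = J"
      unfolding I_def J_def integral_by_parts_exp[OF ab H zero(1,2)]
      using integral_by_parts_exp[OF ab H' H(2,3) zero(3,4), of c] by simp
    then have "cmod (c * (c * I)) = cmod J"
      by simp
    then have "(real_of_int n)\<^sup>2 * cmod I = cmod J"
      by (simp add: c_def norm_mult power2_eq_square)
    also have "cmod J \<le> B * (b - a)"
      unfolding J_def using B
      by (intro integral_bound ab continuous_intros cont) (auto simp: norm_mult c_def)
    finally show "(real_of_int n)\<^sup>2 * cmod (integral {a..b} (\<lambda>t. exp (\<i> * of_int n * of_real t) * H (of_real t)))
        \<le> B * (b - a)"
      by (simp add: I_def c_def)
  qed
qed

lemma deriv_double_zero: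
  assumes K: "K holomorphic_on W" "open W" "a \<in> W"
  shows "deriv (\<lambda>z. (z - a)\<^sup>2 * K z) a = 0"
proof (rule DERIV_imp_deriv)
  have "(K has_field_derivative deriv K a) (at a)"
    by (rule holomorphic_derivI[OF K])
  then show "((\<lambda>z. (z - a)\<^sup>2 * K z) has_field_derivative 0) (at a)"
    by (auto intro!: derivative_eq_intros)
qed

text \<open>An unnormalised Fourier coefficient, at frequency \<open>- n\<close>, of
  \<open>F\<close> on the arc. The polynomial weight is a bump that extends holomorphically, so
  complex derivatives can be used on the real interval.\<close>

definition bump_coefficient :: "real \<Rightarrow> real \<Rightarrow> (complex \<Rightarrow> complex) \<Rightarrow> int \<Rightarrow> complex" where
  "bump_coefficient a b F n = integral {a..b} (\<lambda>t. exp (\<i> * of_int n * of_real t) *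
     (((of_real t - of_real a)\<^sup>2 * (of_real b - of_real t)\<^sup>2) * F (exp (\<i> * of_real t))))"

lemma bump_coefficient_decay:
  assumes ab: "a \<le> b" and F: "F holomorphic_on W" "open W" "\<And>t. t \<in> {a..b} \<Longrightarrow> exp (\<i> * of_real t) \<in> W"
  obtains C where "\<And>n. (real_of_int n)\<^sup>2 * cmod (bump_coefficient a b F n) \<le> C"
proof -
  define V where "V = {z. exp (\<i> * z) \<in> W}"
  have "open V"
    unfolding V_def using open_vimage[OF F(2), of "\<lambda>z. exp (\<i> * z)"]
    by (simp add: vimage_def continuous_intros)
  have FV: "(\<lambda>z. F (exp (\<i> * z))) holomorphic_on V"
    using holomorphic_on_compose_gen[OF _ F(1), of "\<lambda>z. exp (\<i> * z)" V]
    by (auto simp: V_def o_def intro!: holomorphic_intros)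
  have inV: "complex_of_real ` {a..b} \<subseteq> V"
    using F(3) by (auto simp: V_def)
  define H where "H z = ((z - of_real a)\<^sup>2 * (of_real b - z)\<^sup>2) * F (exp (\<i> * z))" for z
  have H: "H holomorphic_on V"
    unfolding H_def by (intro holomorphic_intros FV)
  have "H = (\<lambda>z. (z - of_real a)\<^sup>2 * ((of_real b - z)\<^sup>2 * F (exp (\<i> * z))))"
    by (simp add: H_def mult.assoc fun_eq_iff)
  then have da: "deriv H (of_real a) = 0"
    using inV ab \<open>open V\<close> by (auto intro!: deriv_double_zero[where W = V] holomorphic_intros FV)
  have "H = (\<lambda>z. (z - of_real b)\<^sup>2 * ((z - of_real a)\<^sup>2 * F (exp (\<i> * z))))"
    by (simp add: H_def fun_eq_iff power2_commute[of _ "complex_of_real b"] mult_ac)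
  then have db: "deriv H (of_real b) = 0"
    using inV ab \<open>open V\<close> by (auto intro!: deriv_double_zero[where W = V] holomorphic_intros FV)
  show ?thesis
    by (rule oscillatory_integral_decay[OF ab H \<open>open V\<close> inV _ _ da db])
       (auto simp: H_def bump_coefficient_def intro!: that)
qed

lemma bump_integrand_continuous:
  assumes F: "F holomorphic_on W" "open W" "\<And>t. t \<in> {a..b} \<Longrightarrow> exp (\<i> * of_real t) \<in> W"
  shows "continuous_on {a..b} (\<lambda>t. exp (\<i> * of_int n * of_real t) *
     (((of_real t - of_real a)\<^sup>2 * (of_real b - of_real t)\<^sup>2) * F (exp (\<i> * of_real t))))"
  using F(3) by (intro continuous_intros continuous_on_compose2[OF holomorphic_on_imp_continuous_on[OF F(1)]]) auto

lemma bump_coefficient_add: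
  assumes "F holomorphic_on W" "G holomorphic_on W" "open W" "\<And>t. t \<in> {a..b} \<Longrightarrow> exp (\<i> * of_real t) \<in> W"
  shows "bump_coefficient a b (\<lambda>w. F w + G w) n = bump_coefficient a b F n + bump_coefficient a b G n"
proof -
  let ?h = "\<lambda>F t. exp (\<i> * of_int n * of_real t) *
     (((of_real t - of_real a)\<^sup>2 * (of_real b - of_real t)\<^sup>2) * F (exp (\<i> * of_real t)))"
  have "bump_coefficient a b (\<lambda>w. F w + G w) n = integral {a..b} (\<lambda>t. ?h F t + ?h G t)"
    by (simp add: bump_coefficient_def distrib_left)
  also have "\<dots> = integral {a..b} (?h F) + integral {a..b} (?h G)"
    using assms by (intro integral_add integrable_continuous_interval bump_integrand_continuous)
  finally show ?thesis
    by (simp add: bump_coefficient_def)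
qed

lemma bump_coefficient_scale:
  "bump_coefficient a b (\<lambda>w. c * F w) n = c * bump_coefficient a b F n"
  unfolding bump_coefficient_def by (subst integral_mult_right[symmetric]) (simp add: mult_ac)

text \<open>The variable \<open>w\<close> equals \<open>exp (\<i> * t)\<close> on the arc and raises
  the frequency by one. This turns multiplication by \<open>\<phi>\<close> into a step along the
  orbit.\<close>

lemma bump_coefficient_shift:
  "bump_coefficient a b (\<lambda>w. w * F w) n = bump_coefficient a b F (n + 1)"
  unfolding bump_coefficient_def
  by (rule arg_cong[where f = "integral {a..b}"]) (auto simp: fun_eq_iff algebra_simps exp_add)

lemma bump_coefficient_cong:
  assumes "\<And>t. t \<in> {a..b} \<Longrightarrow> F (exp (\<i> * of_real t)) = G (exp (\<i> * of_real t))"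
  shows "bump_coefficient a b F n = bump_coefficient a b G n"
  unfolding bump_coefficient_def using assms by (intro integral_cong) auto

lemma bump_coefficient_bound:
  assumes ab: "a \<le> b" and F: "F holomorphic_on W" "open W" "\<And>t. t \<in> {a..b} \<Longrightarrow> exp (\<i> * of_real t) \<in> W"
    and B: "\<And>t. t \<in> {a..b} \<Longrightarrow> cmod (F (exp (\<i> * of_real t))) \<le> B"
  shows "cmod (bump_coefficient a b F n) \<le> ((b - a)\<^sup>2 * (b - a)\<^sup>2 * B) * (b - a)"
  unfolding bump_coefficient_def
proof (rule integral_bound[OF ab bump_integrand_continuous[OF F]])
  fix t assume t: "t \<in> {a..b}"
  have "(cmod (of_real t - of_real a))\<^sup>2 \<le> (b - a)\<^sup>2" "(cmod (of_real b - of_real t))\<^sup>2 \<le> (b - a)\<^sup>2"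
    using t by (auto intro!: power_mono simp: norm_of_real simp flip: of_real_diff)
  moreover have "cmod (exp (\<i> * of_int n * of_real t)) = 1"
    by simp
  ultimately show "cmod (exp (\<i> * of_int n * of_real t) *
      (((of_real t - of_real a)\<^sup>2 * (of_real b - of_real t)\<^sup>2) * F (exp (\<i> * of_real t))))
      \<le> (b - a)\<^sup>2 * (b - a)\<^sup>2 * B"
    using B[OF t] order_trans[OF norm_ge_zero B[OF t]]
    by (simp only: norm_mult norm_power mult_1_left) (intro mult_mono; simp)
qed auto

text \<open>If \<open>F\<close> had a value \<open>c \<noteq> 0\<close> at the point, the real part
  of \<open>cnj c * F\<close> would be positive on a short arc centred there, and so would be its
  integral against the bump.\<close>

lemma vanishes_if_bump_coefficients_vanish:
  assumes F: "F holomorphic_on W" "open W" "exp (\<i> * of_real t) \<in> W"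
    and zero: "\<And>a b. a < b \<Longrightarrow> (\<And>s. s \<in> {a..b} \<Longrightarrow> exp (\<i> * of_real s) \<in> W) \<Longrightarrow> bump_coefficient a b F 0 = 0"
  shows "F (exp (\<i> * of_real t)) = 0"
proof (rule ccontr)
  define c where "c = F (exp (\<i> * of_real t))"
  assume "F (exp (\<i> * of_real t)) \<noteq> 0"
  then have c: "c \<noteq> 0" by (simp add: c_def)
  define U where "U = {s. exp (\<i> * complex_of_real s) \<in> W}"
  have U: "open U"
    unfolding U_def using open_vimage[OF F(2), of "\<lambda>s. exp (\<i> * complex_of_real s)"]
    by (simp add: vimage_def continuous_intros)
  define q where "q s = Re (cnj c * F (exp (\<i> * of_real s)))" for s
  have q: "continuous_on U q"
    unfolding q_def
    by (intro continuous_intros continuous_on_compose2[OF holomorphic_on_imp_continuous_on[OF F(1)]])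
       (auto simp: U_def)
  have "q t = (cmod c)\<^sup>2"
    by (simp add: q_def c_def[symmetric] complex_mult_cnj_cmod mult.commute flip: of_real_power)
  then have "q t > 0" using c by simp
  moreover have "open (U \<inter> q -` {0<..})"
    using continuous_open_preimage[OF q U, of "{0<..}"] by simp
  moreover have "t \<in> U"
    using F(3) by (simp add: U_def)
  ultimately obtain d where d: "d > 0" "cball t d \<subseteq> U \<inter> q -` {0<..}"
    using open_contains_cball_eq[of "U \<inter> q -` {0<..}"] by blast
  define a b where "a = t - d" and "b = t + d"
  have ab: "a < b" using d by (simp add: a_def b_def)
  have in_U: "s \<in> U \<and> q s > 0" if "s \<in> {a..b}" for s
    using d that by (auto simp: subset_iff a_def b_def dist_real_def abs_le_iff)
  have W: "exp (\<i> * of_real s) \<in> W" if "s \<in> {a..b}" for s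
    using in_U[OF that] by (simp add: U_def)
  define \<beta> where "\<beta> s = (s - a)\<^sup>2 * (b - s)\<^sup>2" for s :: real
  have "integral {a..b} (\<lambda>s. \<beta> s * q s) = Re (cnj c * bump_coefficient a b F 0)"
  proof -
    have "bounded_linear (\<lambda>z. Re (cnj c * z))"
      by (intro bounded_linear_intros bounded_linear_compose[OF bounded_linear_Re])
    from integral_linear[OF integrable_continuous_interval[OF bump_integrand_continuous[OF F(1,2) W, where n = 0]] this]
    have "Re (cnj c * bump_coefficient a b F 0) = integral {a..b} (\<lambda>s. Re (cnj c *
        ((of_real (\<beta> s)) * F (exp (\<i> * of_real s)))))"
      by (simp add: bump_coefficient_def o_def \<beta>_def)
    also have "\<dots> = integral {a..b} (\<lambda>s. \<beta> s * q s)"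
      unfolding q_def by (intro integral_cong) (simp add: algebra_simps)
    finally show ?thesis by simp
  qed
  also have "\<dots> = 0"
    using zero[OF ab W] by simp
  finally have int0: "integral {a..b} (\<lambda>s. \<beta> s * q s) = 0" .
  have "continuous_on {a..b} (\<lambda>s. \<beta> s * q s)"
    unfolding \<beta>_def using in_U by (intro continuous_intros continuous_on_subset[OF q]) auto
  moreover have "0 \<le> \<beta> s * q s" if "s \<in> {a..b}" for s
    using in_U[OF that] by (simp add: \<beta>_def less_imp_le)
  ultimately have "\<forall>s\<in>{a..b}. \<beta> s * q s = 0"
    using int0 ab by (subst (asm) integral_eq_0_iff) auto
  then have "\<beta> t * q t = 0"
    using d by (simp add: a_def b_def)
  then show False
    using \<open>q t > 0\<close> d by (simp add: \<beta>_def a_def b_def)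
qed

section \<open>From decaying integrals to summable orbits\<close>

lemma summable_orbit_if_quadratic_decay:
  assumes T: "\<And>n. T (y n) = y (n + 1)" and C: "\<And>n. (real_of_int n)\<^sup>2 * norm (y n) \<le> C"
  shows "summable_orbit T y"
  unfolding summable_orbit_def
proof (intro conjI allI impI T)
  fix e :: real assume e: "e > 0"
  have "C \<ge> 0"
    using C[of 0] by simp
  define s where "s n = C / (real n)\<^sup>2" for n
  have "summable s"
    unfolding s_def divide_inverse
    by (intro summable_mult) (use inverse_power_summable[of 2, where 'a = real] in simp)
  then obtain N where N: "\<And>m n. m \<ge> N \<Longrightarrow> norm (sum s {m..<n}) < e / 2"
    using e unfolding summable_Cauchy by (metis half_gt_zero)
  have nat_le: "sum s F \<le> e / 2" if "finite F" "F \<subseteq> {N..}" for F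
  proof -
    have "sum s F \<le> sum s {N..<Suc (Max (insert 0 F))}"
      using that \<open>C \<ge> 0\<close> by (intro sum_mono2) (auto simp: s_def less_Suc_eq_le)
    then show ?thesis
      using N[of N "Suc (Max (insert 0 F))"] by (simp add: abs_less_iff)
  qed
  \<comment> \<open>\<open>Suc N\<close> excludes \<open>m = 0\<close>, where the decay bound
    carries no information. The set is split by sign because the absolute value is injective on each
    half.\<close>
  have "(\<Sum>m\<in>F. norm (y m)) \<le> e" if F: "finite F" "\<forall>m\<in>F. int (Suc N) \<le> \<bar>m\<bar>" for F
  proof -
    have half: "(\<Sum>m\<in>G. norm (y m)) \<le> e / 2"
      if G: "G \<subseteq> F" "inj_on (\<lambda>m. nat \<bar>m\<bar>) G" for G
    proof -
      have "norm (y m) \<le> s (nat \<bar>m\<bar>)" if "m \<in> G" for m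
      proof -
        have "m \<noteq> 0"
          using that G F by force
        then show ?thesis
          using C[of m] by (simp add: s_def field_simps)
      qed
      then have "(\<Sum>m\<in>G. norm (y m)) \<le> (\<Sum>m\<in>G. s (nat \<bar>m\<bar>))"
        by (rule sum_mono)
      also have "\<dots> = sum s ((\<lambda>m. nat \<bar>m\<bar>) ` G)"
        using G(2) by (simp add: sum.reindex)
      also have "\<dots> \<le> e / 2"
        using F G(1) finite_subset[OF G(1)] by (intro nat_le) fastforce+
      finally show ?thesis .
    qed
    have "(\<Sum>m\<in>F. norm (y m)) = (\<Sum>m\<in>F \<inter> {0..}. norm (y m)) + (\<Sum>m\<in>F - {0..}. norm (y m))"
      using F(1) by (rule sum.Int_Diff)
    also have "\<dots> \<le> e / 2 + e / 2"
      by (intro add_mono half) (auto simp: inj_on_def)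
    finally show ?thesis by simp
  qed
  then show "\<exists>N::nat. \<forall>F. finite F \<longrightarrow> (\<forall>m\<in>F. int N \<le> \<bar>m\<bar>) \<longrightarrow> (\<Sum>m\<in>F. norm (y m)) \<le> e"
    by blast
qed

text \<open>\<open>E f w\<close> stands for the value of \<open>f\<close> at the point where the
  symbol of \<open>M\<close> equals \<open>w\<close>. The vector \<open>y n\<close> represents the
  \<open>n\<close>-th bump coefficient; the relation between \<open>M\<close> and \<open>E\<close>
  shifts \<open>n\<close>, and passing to the adjoint makes this
  \<open>y n \<mapsto> y (n + 1)\<close>.\<close>

lemma summable_orbit_from_arc:
  fixes E :: "'h::chilbert_space \<Rightarrow> complex \<Rightarrow> complex"
  assumes M: "bounded_linear M" "complex_homogeneous M"
    and ab: "a \<le> b" and W: "open W" "\<And>t. t \<in> {a..b} \<Longrightarrow> exp (\<i> * of_real t) \<in> W"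
    and hol: "\<And>f. E f holomorphic_on W"
    and lin: "\<And>w. w \<in> W \<Longrightarrow> bounded_linear (\<lambda>f. E f w)"
    and hom: "\<And>c f w. w \<in> W \<Longrightarrow> E (c *\<^sub>C f) w = c * E f w"
    and ME: "\<And>f w. w \<in> W \<Longrightarrow> E (M f) w = w * E f w"
  obtains y where "summable_orbit (cadjoint M) y" "\<And>f. cinner f (y 0) = bump_coefficient a b (E f) 0"
proof -
  let ?L = "\<lambda>n f. bump_coefficient a b (E f) n"
  have hom_L: "?L n (c *\<^sub>C f) = c * ?L n f" for n c f
    unfolding bump_coefficient_scale[symmetric] using W hom by (intro bump_coefficient_cong) auto
  have add_L: "?L n (f + g) = ?L n f + ?L n g" for n f g
  proof -
    have "?L n (f + g) = bump_coefficient a b (\<lambda>w. E f w + E g w) n"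
      using W linear_add[OF bounded_linear.linear[OF lin]] by (intro bump_coefficient_cong) auto
    also have "\<dots> = ?L n f + ?L n g"
      by (rule bump_coefficient_add[OF hol hol W])
    finally show ?thesis .
  qed
  have shift_L: "?L n (M f) = ?L (n + 1) f" for n f
    unfolding bump_coefficient_shift[symmetric] using W ME by (intro bump_coefficient_cong) auto
  \<comment> \<open>Compactness bounds the values along the arc for each \<open>f\<close>; uniform
    boundedness then gives one constant times \<open>norm f\<close>, so that \<open>?L n\<close> is
    a bounded functional.\<close>
  have "\<exists>K. \<forall>t\<in>{a..b}. cmod (E f (exp (\<i> * of_real t))) \<le> K" for f
  proof -
    have "continuous_on {a..b} (\<lambda>t. E f (exp (\<i> * of_real t)))"
      using W(2) by (intro continuous_intros continuous_on_compose2[OF holomorphic_on_imp_continuous_on[OF hol]]) auto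
    then have "bounded ((\<lambda>t. E f (exp (\<i> * of_real t))) ` {a..b})"
      by (intro compact_imp_bounded compact_continuous_image) auto
    then show ?thesis
      unfolding bounded_iff by auto
  qed
  then obtain K where K: "0 \<le> K" "\<And>t f. t \<in> {a..b} \<Longrightarrow> cmod (E f (exp (\<i> * of_real t))) \<le> K * norm f"
    using uniform_boundedness[of "{a..b}" "\<lambda>t f. E f (exp (\<i> * of_real t))"] W lin by metis
  have lin_L: "bounded_linear (?L n)" for n
  proof (rule bounded_linear_intro[where K = "(b - a)\<^sup>2 * (b - a)\<^sup>2 * K * (b - a)"])
    show "?L n (r *\<^sub>R f) = r *\<^sub>R ?L n f" for r f
      by (simp add: scaleR_scaleC hom_L scaleR_conv_of_real)
    show "cmod (?L n f) \<le> norm f * ((b - a)\<^sup>2 * (b - a)\<^sup>2 * K * (b - a))" for f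
      using bump_coefficient_bound[OF ab hol W K(2)] by (simp add: mult_ac)
  qed (rule add_L)
  have "\<exists>y. \<forall>f. ?L n f = cinner f y" for n
    using Riesz_representation[OF lin_L] hom_L unfolding complex_functional_def by metis
  then obtain y where y: "\<And>n f. ?L n f = cinner f (y n)"
    by metis
  have "cadjoint M (y n) = y (n + 1)" for n
    by (rule cinner_ext) (simp add: cadjoint_works[OF M, symmetric] y[symmetric] shift_L)
  \<comment> \<open>The decay constant depends on \<open>f\<close>. Applying uniform boundedness to
    the functionals scaled by the square of \<open>n\<close> removes this dependence.\<close>
  moreover have "\<exists>C. \<forall>n. (real_of_int n)\<^sup>2 * norm (y n) \<le> C"
  proof -
    have "bounded_linear (\<lambda>f. (real_of_int n)\<^sup>2 *\<^sub>R ?L n f)" for n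
      using bounded_linear_compose[OF bounded_linear_scaleR_right lin_L] by simp
    moreover have "\<exists>C. \<forall>n\<in>UNIV. norm ((real_of_int n)\<^sup>2 *\<^sub>R ?L n f) \<le> C" for f
      using bump_coefficient_decay[OF ab hol W] by (simp, metis)
    ultimately obtain C where C: "0 \<le> C" "\<And>n f. norm ((real_of_int n)\<^sup>2 *\<^sub>R ?L n f) \<le> C * norm f"
      using uniform_boundedness[of UNIV "\<lambda>n f. (real_of_int n)\<^sup>2 *\<^sub>R ?L n f"] by (metis UNIV_I)
    have "norm (of_real ((real_of_int n)\<^sup>2) *\<^sub>C y n) \<le> C" for n
    proof (rule norm_le_if_cinner_le[OF C(1)])
      show "cmod (cinner f (of_real ((real_of_int n)\<^sup>2) *\<^sub>C y n)) \<le> C * norm f" for f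
        using C(2)[of n f] by (simp add: y cinner_scaleC_right norm_mult norm_power)
    qed
    then show ?thesis
      by (auto simp: norm_scaleC norm_power)
  qed
  ultimately have "summable_orbit (cadjoint M) y"
    using summable_orbit_if_quadratic_decay by metis
  then show ?thesis
    using that y by simp
qed

section \<open>Holomorphic functions\<close>

lemma unit_circle_islimpt:
  assumes "cmod w = 1" "open U" "w \<in> U"
  shows "w islimpt (sphere 0 1 \<inter> U)"
proof -
  have "- w \<noteq> w" "- w \<in> sphere 0 1" "w \<in> sphere 0 1"
    using assms(1) by auto
  then have "\<nexists>x. sphere (0::complex) 1 = {x}"
    by (metis singletonD)
  then have "w islimpt (sphere (0::complex) 1)"
    using assms(1) by (intro connected_imp_perfect connected_sphere) auto
  then show ?thesis
    using assms(2,3) unfolding islimpt_def by (metis IntI open_Int IntD1 IntD2)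
qed

text \<open>The derivative may vanish at \<open>p0\<close>, but its zeros do not accumulate there.
  By the open mapping theorem and the perfectness of the circle there are other unimodular values
  near \<open>p0\<close>, hence a point \<open>p\<close> with non-zero derivative, where
  \<open>g\<close> is locally invertible.\<close>

lemma unimodular_local_inverse:
  assumes g: "g holomorphic_on D" and D: "open D" "connected D" and nc: "\<not> g constant_on D"
    and p0: "p0 \<in> D" "cmod (g p0) = 1"
  obtains W c w where "open W" "connected W" "c holomorphic_on W" "open (c ` W)" "c ` W \<subseteq> D"
    "\<And>w. w \<in> W \<Longrightarrow> g (c w) = w" "w \<in> W" "cmod w = 1"
proof -
  let ?Z = "{z\<in>D. deriv g z = 0}"
  have "\<not> p0 islimpt ?Z"
  proof
    assume lim: "p0 islimpt ?Z"
    have "deriv g z = 0" if "z \<in> D" for z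
      by (rule analytic_continuation[OF holomorphic_deriv[OF g D(1)] D _ p0(1) lim _ that]) auto
    then have "(g has_field_derivative 0) (at z)" if "z \<in> D" for z
      using holomorphic_derivI[OF g D(1) that] that by simp
    then have "g constant_on D"
      using DERIV_zero_connected_constant[OF D(2,1) finite.emptyI, of g]
        holomorphic_on_imp_continuous_on[OF g] unfolding constant_on_def by (metis DiffD1)
    then show False using nc by blast
  qed
  then obtain e where e: "e > 0" "\<And>z. z \<in> D \<Longrightarrow> z \<noteq> p0 \<Longrightarrow> dist z p0 < e \<Longrightarrow> deriv g z \<noteq> 0"
    unfolding islimpt_approachable by auto
  obtain e' where e': "e' > 0" "ball p0 e' \<subseteq> D"
    using D(1) p0(1) open_contains_ball by blast
  define r where "r = min e e'"
  have r: "r > 0" "ball p0 r \<subseteq> D"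
    using e e' by (auto simp: r_def)
  have "open (g ` ball p0 r)"
    by (rule open_mapping_thm[OF g D open_ball r(2) nc])
  then have "g p0 islimpt (sphere 0 1 \<inter> g ` ball p0 r)"
    using r by (intro unit_circle_islimpt p0) auto
  then obtain u where u: "u \<in> sphere 0 1" "u \<in> g ` ball p0 r" "u \<noteq> g p0"
    unfolding islimpt_def by (metis Int_iff UNIV_I open_UNIV)
  then obtain p where "p \<in> ball p0 r" "u = g p"
    by blast
  with u have p: "p \<in> ball p0 r" "cmod (g p) = 1" "p \<noteq> p0"
    by auto
  have "deriv g p \<noteq> 0" "p \<in> D"
    using e(2)[of p] p r by (auto simp: r_def dist_commute)
  then obtain s where s: "s > 0" "ball p s \<subseteq> D" "open (g ` ball p s)" "inj_on g (ball p s)"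
    using has_complex_derivative_locally_invertible[OF g _ D(1)] by metis
  then obtain c where c: "c holomorphic_on g ` ball p s" "\<And>z. z \<in> ball p s \<Longrightarrow> c (g z) = z"
    using holomorphic_has_inverse[OF holomorphic_on_subset[OF g s(2)] open_ball s(4)] by metis
  have img: "c ` g ` ball p s = ball p s"
    using c(2) by (force simp: image_iff)
  show ?thesis
  proof (rule that[of "g ` ball p s" c "g p"])
    show "connected (g ` ball p s)"
      by (intro connected_continuous_image connected_ball holomorphic_on_imp_continuous_on
          holomorphic_on_subset[OF g s(2)])
    show "open (c ` g ` ball p s)" "c ` g ` ball p s \<subseteq> D"
      unfolding img using s(2) by auto
    show "g (c w) = w" if "w \<in> g ` ball p s" for w
      using that c(2) by auto
  qed (use c s p in auto)
qed

lemma bounded_linear_vector_scalar_mult: "bounded_linear (\<lambda>c. c *s (v :: complex ^ 'n))"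
  unfolding linear_conv_bounded_linear[symmetric]
  by (rule linearI) (simp_all add: vec_eq_iff algebra_simps)

section \<open>Several variables: complex lines and the identity theorem\<close>

lemma cholomorphic_on_line:
  assumes f: "cholomorphic_on f S" and S: "open S"
  shows "(\<lambda>c. f (z + c *s v)) holomorphic_on {c. z + c *s v \<in> S}"
proof (rule holomorphic_onI)
  fix c assume c: "c \<in> {c. z + c *s v \<in> S}"
  then obtain D where D: "(f has_derivative D) (at (z + c *s v))" "\<And>c v. D (c *s v) = c * D v"
    using f S unfolding cholomorphic_on_def by (metis at_within_open mem_Collect_eq)
  have "((\<lambda>c. z + c *s v) has_derivative (\<lambda>c. c *s v)) (at c)"
    by (auto intro!: derivative_eq_intros bounded_linear_imp_has_derivative bounded_linear_vector_scalar_mult)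
  from has_derivative_compose[OF this D(1)]
  have "((\<lambda>c. f (z + c *s v)) has_derivative (\<lambda>c. D (c *s v))) (at c)" .
  moreover have "(\<lambda>c. D (c *s v)) = (*) (D v)"
    by (simp add: fun_eq_iff D(2))
  ultimately have "((\<lambda>c. f (z + c *s v)) has_field_derivative D v) (at c)"
    unfolding has_field_derivative_def by simp
  then show "(\<lambda>c. f (z + c *s v)) field_differentiable at c within {c. z + c *s v \<in> S}"
    using field_differentiable_at_within field_differentiable_def by blast
qed

lemma cholomorphic_on_imp_continuous_on:
  assumes "cholomorphic_on f S"
  shows "continuous_on S f"
  using assms unfolding cholomorphic_on_def continuous_on_eq_continuous_within
  by (blast intro: has_derivative_continuous)

lemma cholomorphic_on_diff_const:
  assumes "cholomorphic_on f S"
  shows "cholomorphic_on (\<lambda>z. f z - c) S"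
  unfolding cholomorphic_on_def
proof
  fix z assume "z \<in> S"
  then obtain D where "(f has_derivative D) (at z within S)" "\<forall>c v. D (c *s v) = c * D v"
    using assms unfolding cholomorphic_on_def by blast
  then show "\<exists>D. ((\<lambda>z. f z - c) has_derivative D) (at z within S) \<and> (\<forall>c v. D (c *s v) = c * D v)"
    by (intro exI[of _ D]) (auto intro!: derivative_eq_intros)
qed

lemma cholomorphic_on_inverse:
  assumes "cholomorphic_on f S" "\<And>z. z \<in> S \<Longrightarrow> f z \<noteq> 0"
  shows "cholomorphic_on (\<lambda>z. inverse (f z)) S"
  unfolding cholomorphic_on_def
proof
  fix z assume z: "z \<in> S"
  then obtain D where "(f has_derivative D) (at z within S)" "\<forall>c v. D (c *s v) = c * D v"
    using assms(1) unfolding cholomorphic_on_def by blast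
  then show "\<exists>D. ((\<lambda>z. inverse (f z)) has_derivative D) (at z within S) \<and> (\<forall>c v. D (c *s v) = c * D v)"
    using Deriv.has_derivative_inverse[of f z, OF assms(2)[OF z]]
    by (intro exI[of _ "\<lambda>h. - (inverse (f z) * D h * inverse (f z))"]) auto
qed

lemma line_in_ball:
  fixes a d :: "complex ^ 'n"
  shows "open {c. a + c *s d \<in> ball z r}" "connected {c. a + c *s d \<in> ball z r}"
proof -
  have eq: "{c. a + c *s d \<in> ball z r} = (\<lambda>c. c *s d) -` ball (z - a) r"
    by (auto simp: dist_norm diff_diff_add)
  show "open {c. a + c *s d \<in> ball z r}"
    unfolding eq using bounded_linear.continuous_on[OF bounded_linear_vector_scalar_mult continuous_on_id]
    by (intro open_vimage) auto
  show "connected {c. a + c *s d \<in> ball z r}"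
    unfolding eq using bounded_linear.linear[OF bounded_linear_vector_scalar_mult]
    by (intro convex_connected convex_linear_vimage) auto
qed

text \<open>The parameters of the line inside the ball form a convex open set, so the one-variable
  identity theorem carries the zeros from \<open>C\<close> to the parameter 1, which is
  \<open>w\<close>.\<close>

lemma cholomorphic_zero_on_line:
  assumes f: "cholomorphic_on f S" "open S" and B: "ball z r \<subseteq> S" "a \<in> ball z r" "w \<in> ball z r"
    and C: "open C" "C \<noteq> {}" "C \<subseteq> {c. a + c *s (w - a) \<in> ball z r}"
    and zero: "\<And>c. c \<in> C \<Longrightarrow> f (a + c *s (w - a)) = 0"
  shows "f w = 0"
proof -
  let ?L = "{c. a + c *s (w - a) \<in> ball z r}"
  have hol: "(\<lambda>c. f (a + c *s (w - a))) holomorphic_on ?L"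
    using B(1) by (intro holomorphic_on_subset[OF cholomorphic_on_line[OF f]]) auto
  have one: "1 \<in> ?L"
    using B by simp
  have "f (a + 1 *s (w - a)) = 0"
    by (rule analytic_continuation_open[OF C(1) line_in_ball(1) C(2) line_in_ball(2) C(3) hol
          holomorphic_on_const zero one])
  then show ?thesis by simp
qed

text \<open>The interior \<open>A\<close> of the zero set is relatively closed: a ball around a
  limit point of \<open>A\<close> contains some \<open>a\<close> in \<open>A\<close>, and every line
  from \<open>a\<close> inside the ball starts with an open set of zeros. Connectedness then gives
  \<open>A = \<Omega>\<close>.\<close>

lemma cholomorphic_identity:
  assumes f: "cholomorphic_on f \<Omega>" and \<Omega>: "open \<Omega>" "connected \<Omega>"
    and N: "open N" "N \<noteq> {}" "N \<subseteq> \<Omega>" "\<And>z. z \<in> N \<Longrightarrow> f z = 0" and w: "w \<in> \<Omega>"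
  shows "f w = 0"
proof -
  define A where "A = interior {z\<in>\<Omega>. f z = 0}"
  have A0: "f z = 0" "z \<in> \<Omega>" if "z \<in> A" for z
    using that interior_subset unfolding A_def by blast+
  have "N \<subseteq> A"
    unfolding A_def using N by (intro interior_maximal) auto
  have "\<Omega> \<inter> closure A \<subseteq> A"
  proof
    fix z assume z: "z \<in> \<Omega> \<inter> closure A"
    then obtain r where r: "r > 0" "ball z r \<subseteq> \<Omega>"
      using \<Omega>(1) open_contains_ball by blast
    obtain a where a: "a \<in> A" "a \<in> ball z r"
      using z r by (metis IntD2 closure_approachable dist_commute mem_ball)
    have "f u = 0" if u: "u \<in> ball z r" for u
    proof -
      let ?h = "\<lambda>c. a + c *s (u - a)"
      let ?C = "{c. ?h c \<in> ball z r} \<inter> ?h -` A"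
      have "open (?h -` A)"
        unfolding A_def
        by (intro open_vimage open_interior continuous_intros
            bounded_linear.continuous_on[OF bounded_linear_vector_scalar_mult])
      then have "open ?C"
        by (intro open_Int line_in_ball)
      moreover have "0 \<in> ?C"
        using a by simp
      then have "?C \<noteq> {}"
        by blast
      moreover have "f (?h c) = 0" if "c \<in> ?C" for c
        using that A0(1) by blast
      ultimately show ?thesis
        by (intro cholomorphic_zero_on_line[OF f \<Omega>(1) r(2) a(2) u, of ?C]) auto
    qed
    then have "ball z r \<subseteq> A"
      unfolding A_def using r by (intro interior_maximal) auto
    then show "z \<in> A"
      using r by auto
  qed
  then have "closedin (top_of_set \<Omega>) A"
    using A0(2) closure_subset[of A] by (auto simp: closedin_closed intro!: exI[of _ "closure A"])
  moreover have "openin (top_of_set \<Omega>) A"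
    using A0(2) by (auto simp: A_def openin_open_eq \<Omega>)
  ultimately have "A = \<Omega>"
    using \<Omega>(2) N \<open>N \<subseteq> A\<close> by (auto simp: connected_clopen)
  then show ?thesis
    using A0 w by blast
qed

section \<open>Multiplication operators\<close>

context holomorphic_hilbert_space
begin

lemma ev_bounded_linear:
  assumes z: "z \<in> \<Omega>"
  shows "bounded_linear (\<lambda>f. ev f z)"
proof -
  obtain K where "\<forall>f. norm (ev f z) \<le> K * norm f"
    using ev_bounded[OF z] by blast
  then show ?thesis
    using z by (intro bounded_linear_intro[where K = K])
      (auto simp: ev_add ev_scaleC scaleR_scaleC scaleR_conv_of_real mult.commute)
qed

lemma ev_zero: "z \<in> \<Omega> \<Longrightarrow> ev 0 z = 0"
  using ev_scaleC[of z 0 0] by simp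

lemma reproducing_kernel_exists:
  obtains k where "\<And>f z. z \<in> \<Omega> \<Longrightarrow> ev f z = cinner f (k z)"
proof -
  have "\<exists>y. \<forall>f. ev f z = cinner f y" if z: "z \<in> \<Omega>" for z
    using Riesz_representation[OF ev_bounded_linear[OF z]] ev_scaleC[OF z]
    unfolding complex_functional_def by metis
  then show ?thesis
    using that by metis
qed

lemma ev_mult_op:
  assumes "multiplier \<Omega> ev \<psi>" and "z \<in> \<Omega>"
  shows "ev (mult_op \<Omega> ev \<psi> f) z = \<psi> z * ev f z"
proof -
  obtain g where g: "\<forall>z\<in>\<Omega>. ev g z = \<psi> z * ev f z"
    using assms(1) unfolding multiplier_def by blast
  have "\<forall>z\<in>\<Omega>. ev (mult_op \<Omega> ev \<psi> f) z = \<psi> z * ev f z"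
    unfolding mult_op_def by (rule theI[of _ g]) (use g in \<open>auto intro!: ev_inject\<close>)
  then show ?thesis
    using assms(2) by blast
qed

lemma mult_op_homogeneous:
  assumes "multiplier \<Omega> ev \<psi>"
  shows "complex_homogeneous (mult_op \<Omega> ev \<psi>)"
  unfolding complex_homogeneous_def
  by (intro allI ev_inject) (simp add: ev_mult_op[OF assms] ev_scaleC)

text \<open>The closed graph theorem for \<open>M\<close>: its formal adjoint is defined on the span \<open>V\<close> of the
  reproducing kernels, so the uniform boundedness principle applies to the functionals
  \<open>f \<mapsto> \<langle>M f, y\<rangle>\<close> with \<open>y\<close> in the unit ball of \<open>V\<close>.\<close>

lemma mult_op_bounded_linear:
  assumes mult: "multiplier \<Omega> ev \<psi>"
  shows "bounded_linear (mult_op \<Omega> ev \<psi>)"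
proof -
  let ?M = "mult_op \<Omega> ev \<psi>"
  obtain k where k: "\<And>f z. z \<in> \<Omega> \<Longrightarrow> ev f z = cinner f (k z)"
    using reproducing_kernel_exists by metis
  define V where "V = {y. \<exists>y'. \<forall>f. cinner (?M f) y = cinner f y'}"
  have "csubspace V"
    unfolding csubspace_def
  proof (intro conjI ballI allI)
    show "0 \<in> V"
      unfolding V_def by (auto intro!: exI[of _ 0])
    fix x assume x: "x \<in> V"
    then obtain x' where x': "\<forall>f. cinner (?M f) x = cinner f x'"
      unfolding V_def by blast
    show "c *\<^sub>C x \<in> V" for c
      unfolding V_def using x' by (auto simp: cinner_scaleC_right intro!: exI[of _ "c *\<^sub>C x'"])
    fix y assume "y \<in> V"
    then obtain y' where "\<forall>f. cinner (?M f) y = cinner f y'"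
      unfolding V_def by blast
    then show "x + y \<in> V"
      unfolding V_def using x' by (auto simp: cinner_add_right intro!: exI[of _ "x' + y'"])
  qed
  moreover have "k z \<in> V" if z: "z \<in> \<Omega>" for z
  proof -
    have "cinner (?M f) (k z) = cinner f (cnj (\<psi> z) *\<^sub>C k z)" for f
      using ev_mult_op[OF mult z, of f] by (simp add: k[OF z] cinner_scaleC_right)
    then show ?thesis
      unfolding V_def by blast
  qed
  then have "x = 0" if "\<And>v. v \<in> V \<Longrightarrow> cinner x v = 0" for x
    using that by (intro ev_inject) (simp add: ev_zero k)
  ultimately have dense: "closure V = UNIV"
    by (rule dense_if_orthogonal_trivial)
  have "bounded_linear (\<lambda>f. cinner (?M f) y)" if "y \<in> V \<inter> cball 0 1" for y
    using that bounded_linear_cinner_left unfolding V_def by auto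
  moreover have "\<exists>K. \<forall>y\<in>V \<inter> cball 0 1. cmod (cinner (?M f) y) \<le> K" for f
  proof (intro exI ballI)
    fix y assume "y \<in> V \<inter> cball 0 1"
    then show "cmod (cinner (?M f) y) \<le> norm (?M f) * 1"
      using cinner_Cauchy_Schwarz[of "?M f" y] mult_left_mono[of "norm y" 1 "norm (?M f)"] by simp
  qed
  ultimately obtain K where K: "0 \<le> K" "\<And>y f. y \<in> V \<inter> cball 0 1 \<Longrightarrow> cmod (cinner (?M f) y) \<le> K * norm f"
    using uniform_boundedness[of "V \<inter> cball 0 1" "\<lambda>y f. cinner (?M f) y"] by metis
  have bound: "norm (?M f) \<le> K * norm f" for f
  proof -
    have "cmod (cinner (?M f) y) \<le> K * norm f * norm y" if y: "y \<in> V" for y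
    proof (cases "y = 0")
      case False
      have "of_real (inverse (norm y)) *\<^sub>C y \<in> V \<inter> cball 0 1"
        using y \<open>csubspace V\<close> False unfolding csubspace_def
        by (simp add: norm_scaleC norm_inverse)
      from K(2)[OF this, of f] show ?thesis
        using False by (simp add: cinner_scaleC_right norm_mult norm_inverse norm_divide field_simps)
    qed simp
    then have "V \<subseteq> {y. cmod (cinner (?M f) y) \<le> K * norm f * norm y}"
      by blast
    moreover have "closed {y. cmod (cinner (?M f) y) \<le> K * norm f * norm y}"
      by (intro closed_Collect_le continuous_intros
          bounded_linear.continuous_on[OF bounded_linear_cinner_right])
    \<comment> \<open>By density the estimate holds for all \<open>y\<close>; choosing
      \<open>y\<close> as the image of \<open>f\<close> bounds the operator.\<close>
    ultimately have "closure V \<subseteq> {y. cmod (cinner (?M f) y) \<le> K * norm f * norm y}"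
      by (rule closure_minimal)
    then have "norm (?M f) * norm (?M f) \<le> K * norm f * norm (?M f)"
      using dense by (auto simp: cinner_self norm_power power2_eq_square norm_mult dest!: subsetD[where c = "?M f"])
    then show ?thesis
      using K(1) by (cases "?M f = 0") auto
  qed
  show ?thesis
  proof (rule bounded_linear_intro[where K = K])
    show "?M (f + g) = ?M f + ?M g" for f g
      by (rule ev_inject) (simp add: ev_mult_op[OF mult] ev_add algebra_simps)
    show "?M (r *\<^sub>R f) = r *\<^sub>R ?M f" for r f
      using mult_op_homogeneous[OF mult] by (simp add: scaleR_scaleC complex_homogeneous_def)
    show "norm (?M f) \<le> norm f * K" for f
      using bound[of f] by (simp add: mult.commute)
  qed
qed

lemma cadjoint_mult_op_eigenvector:
  assumes mult: "multiplier \<Omega> ev \<psi>" and k: "\<And>f. ev f z = cinner f k" and z: "z \<in> \<Omega>"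
  shows "cadjoint (mult_op \<Omega> ev \<psi>) k = cnj (\<psi> z) *\<^sub>C k"
proof (rule cinner_ext)
  fix f
  have "cinner f (cadjoint (mult_op \<Omega> ev \<psi>) k) = cinner (mult_op \<Omega> ev \<psi> f) k"
    by (simp add: cadjoint_works mult_op_bounded_linear mult_op_homogeneous mult)
  then show "cinner f (cadjoint (mult_op \<Omega> ev \<psi>) k) = cinner f (cnj (\<psi> z) *\<^sub>C k)"
    using ev_mult_op[OF mult z, of f] by (simp add: k cinner_scaleC_right)
qed

end

section \<open>Density of the vectors with summable orbits\<close>

lemma dense_countable_if_countable_total:
  fixes K :: "'h::chilbert_space set"
  assumes K: "countable K" and total: "\<And>x. (\<And>k. k \<in> K \<Longrightarrow> cinner x k = 0) \<Longrightarrow> x = 0"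
  obtains A :: "'h set" where "countable A" "closure A = UNIV"
proof -
  obtain Q :: "complex set" where Q: "countable Q" "\<And>X. open X \<Longrightarrow> X \<noteq> {} \<Longrightarrow> \<exists>d\<in>Q. d \<in> X"
    using countable_dense_setE by blast
  \<comment> \<open>Lists make countability immediate, and concatenation of lists is addition of
    vectors.\<close>
  define A where "A = (\<lambda>l. sum_list (map (\<lambda>(q, k). q *\<^sub>C k) l)) ` lists (Q \<times> K)"
  have "countable A"
    unfolding A_def using Q(1) K by (intro countable_image countable_lists) auto
  have zero: "0 \<in> A"
    unfolding A_def by (auto intro!: image_eqI[of _ _ "[]"])
  have add_A: "x + y \<in> A" if xy: "x \<in> A" "y \<in> A" for x y
  proof -
    obtain l where "x = sum_list (map (\<lambda>(q, k). q *\<^sub>C k) l)" "l \<in> lists (Q \<times> K)"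
      using xy(1) unfolding A_def by (rule imageE)
    moreover obtain m where "y = sum_list (map (\<lambda>(q, k). q *\<^sub>C k) m)" "m \<in> lists (Q \<times> K)"
      using xy(2) unfolding A_def by (rule imageE)
    ultimately show ?thesis
      unfolding A_def by (intro image_eqI[of _ _ "l @ m"]) auto
  qed
  have add: "x + y \<in> closure A" if "x \<in> closure A" "y \<in> closure A" for x y
  proof -
    obtain a b where "\<And>n. a n \<in> A" "a \<longlonglongrightarrow> x" "\<And>n. b n \<in> A" "b \<longlonglongrightarrow> y"
      using \<open>x \<in> closure A\<close> \<open>y \<in> closure A\<close> unfolding closure_sequential by blast
    then show ?thesis
      using add_A unfolding closure_sequential
      by (intro exI[of _ "\<lambda>n. a n + b n"]) (auto intro: tendsto_add)
  qed
  \<comment> \<open>\<open>A\<close> is closed under addition but not known to be closed under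
    scaling, since \<open>Q\<close> is merely a dense set. \<open>V\<close> is the part of
    \<open>closure A\<close> that stays inside under all complex multiples.\<close>
  define V where "V = {x. \<forall>c. c *\<^sub>C x \<in> closure A}"
  have "csubspace V"
    unfolding csubspace_def V_def
    using zero closure_subset[of A] add by (auto simp: scaleC_add_right scaleC_scaleC)
  moreover have "k \<in> V" if k: "k \<in> K" for k
  proof -
    have "c *\<^sub>C k \<in> closure A" for c
      unfolding closure_approachable
    proof (intro allI impI)
      fix e :: real assume e: "e > 0"
      have "0 < e / (norm k + 1)"
        using e by (intro divide_pos_pos add_nonneg_pos) auto
      then have "\<exists>q\<in>Q. q \<in> ball c (e / (norm k + 1))"
        by (intro Q(2)) auto
      then obtain q where q: "q \<in> Q" "cmod (c - q) < e / (norm k + 1)"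
        by (auto simp: dist_norm)
      have "q *\<^sub>C k \<in> A"
        unfolding A_def using q k by (intro image_eqI[of _ _ "[(q, k)]"]) auto
      moreover have "dist (q *\<^sub>C k) (c *\<^sub>C k) = cmod (c - q) * norm k"
        by (simp add: dist_norm norm_minus_commute norm_scaleC flip: scaleC_diff_left)
      moreover have "cmod (c - q) * norm k \<le> cmod (c - q) * (norm k + 1)"
        by (intro mult_left_mono) auto
      moreover have "cmod (c - q) * (norm k + 1) < e"
        using q(2) norm_ge_zero[of k] by (simp add: pos_less_divide_eq add_nonneg_pos)
      ultimately show "\<exists>y\<in>A. dist y (c *\<^sub>C k) < e"
        by (metis le_less_trans)
    qed
    then show ?thesis
      unfolding V_def by blast
  qed
  then have "x = 0" if "\<And>v. v \<in> V \<Longrightarrow> cinner x v = 0" for x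
    using that total by blast
  ultimately have "closure V = UNIV"
    by (rule dense_if_orthogonal_trivial)
  moreover have "V \<subseteq> closure A"
    unfolding V_def by (metis (mono_tags, lifting) mem_Collect_eq scaleC_one subsetI)
  ultimately have "closure A = UNIV"
    by (metis closed_closure closure_minimal top.extremum_uniqueI)
  with \<open>countable A\<close> show ?thesis
    using that by blast
qed

text \<open>The points of \<open>A\<close> may lie outside \<open>V\<close>, so each is replaced by
  a sequence of points of \<open>V\<close> converging to it.\<close>

lemma dense_sequence_in_dense_set:
  fixes A V :: "'a::metric_space set"
  assumes A: "countable A" "closure A = UNIV" and V: "closure V = UNIV"
  obtains s :: "nat \<Rightarrow> 'a" where "\<And>n. s n \<in> V" "closure (range s) = UNIV"
proof -
  have "A \<noteq> {}"
    using A(2) by auto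
  then obtain f :: "nat \<Rightarrow> 'a" where f: "range f = A"
    using A(1) uncountable_def by blast
  have "\<exists>v\<in>V. dist v (f m) < 1 / (real n + 1)" for m n
    using V closure_approachable[of "f m" V] by (metis UNIV_I of_nat_0_less_iff of_nat_Suc add.commute zero_less_Suc zero_less_divide_1_iff)
  then obtain g where g: "\<And>m n. g m n \<in> V" "\<And>m n. dist (g m n) (f m) < 1 / (real n + 1)"
    by metis
  define s where "s i = (case prod_decode i of (m, n) \<Rightarrow> g m n)" for i
  have gs: "g m n \<in> range s" for m n
    by (intro range_eqI[of _ _ "prod_encode (m, n)"]) (simp add: s_def)
  have "x \<in> closure (range s)" for x
    unfolding closure_approachable
  proof (intro allI impI)
    fix e :: real assume e: "e > 0"
    obtain m where m: "dist (f m) x < e / 2"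
      using A(2) f e closure_approachable[of x A] by (metis UNIV_I half_gt_zero rangeE)
    obtain n where n: "1 / (real n + 1) < e / 2"
      using e nat_approx_posE[of "e / 2"] by (auto simp: add.commute)
    have "dist (g m n) x < e"
      using dist_triangle[of "g m n" x "f m"] g(2)[of m n] m n by simp
    then show "\<exists>y\<in>range s. dist y x < e"
      using gs by blast
  qed
  then have "closure (range s) = UNIV"
    by blast
  moreover have "s n \<in> V" for n
    using g(1) by (simp add: s_def split: prod.split)
  ultimately show ?thesis
    by (rule that[rotated])
qed

lemma csubspace_summable_orbits:
  fixes T :: "'h::chilbert_space \<Rightarrow> 'h"
  assumes "bounded_linear T" "complex_homogeneous T"
  shows "csubspace {y 0 |y. summable_orbit T y}"
  unfolding csubspace_def
proof (intro conjI ballI allI)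
  show "0 \<in> {y 0 |y. summable_orbit T y}"
    using summable_orbit_zero[OF assms(1)] by (intro CollectI exI[of _ "\<lambda>_. 0"]) simp
  fix x assume "x \<in> {y 0 |y. summable_orbit T y}"
  then obtain y where y: "x = y 0" "summable_orbit T y"
    by blast
  show "c *\<^sub>C x \<in> {y 0 |y. summable_orbit T y}" for c
    using summable_orbit_scaleC[OF assms(2) y(2), of c] y(1)
    by (intro CollectI exI[of _ "\<lambda>m. c *\<^sub>C y m"]) simp
  fix x' assume "x' \<in> {y 0 |y. summable_orbit T y}"
  then obtain y' where y': "x' = y' 0" "summable_orbit T y'"
    by blast
  show "x + x' \<in> {y 0 |y. summable_orbit T y}"
    using summable_orbit_add[OF assms(1) y(2) y'(2)] y(1) y'(1)
    by (intro CollectI exI[of _ "\<lambda>m. y m + y' m"]) simp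
qed

context holomorphic_hilbert_space
begin

text \<open>By continuity a function vanishing at a countable dense set of points is zero, so
  countably many reproducing kernels are total. Frequent hypercyclicity needs this to list the
  orbits in a sequence.\<close>

lemma separable:
  assumes "open \<Omega>"
  obtains A :: "'h set" where "countable A" "closure A = UNIV"
proof -
  obtain k where k: "\<And>f z. z \<in> \<Omega> \<Longrightarrow> ev f z = cinner f (k z)"
    using reproducing_kernel_exists by metis
  obtain D :: "(complex ^ 'n) set" where
    D: "countable D" "\<And>X. open X \<Longrightarrow> X \<noteq> {} \<Longrightarrow> \<exists>d\<in>D. d \<in> X"
    using countable_dense_setE by blast
  have "countable (k ` (D \<inter> \<Omega>))"
    using D(1) by auto
  moreover have "f = 0" if f: "\<And>v. v \<in> k ` (D \<inter> \<Omega>) \<Longrightarrow> cinner f v = 0" for f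
  proof (rule ev_inject)
    fix z assume z: "z \<in> \<Omega>"
    have "open (\<Omega> \<inter> ev f -` (- {0}))"
      using cholomorphic_on_imp_continuous_on[OF ev_holomorphic] assms
      by (intro continuous_open_preimage) auto
    moreover have "d \<notin> \<Omega> \<inter> ev f -` (- {0})" if "d \<in> D" for d
      using f that k by auto
    ultimately have "\<Omega> \<inter> ev f -` (- {0}) = {}"
      using D(2) by blast
    then show "ev f z = ev 0 z"
      using z ev_zero by auto
  qed
  ultimately show ?thesis
    using dense_countable_if_countable_total that by blast
qed

text \<open>Through a point \<open>z\<^sub>0\<close> with \<open>\<bar>\<phi> z\<^sub>0\<bar> = 1\<close> take a line on which \<open>\<phi>\<close> is not constant. Near a point of
  the line \<open>\<phi>\<close> has a local inverse \<open>c\<close> over an arc of the unit circle, and \<open>T\<close> multiplies the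
  reproducing kernel at \<open>c w\<close> by \<open>cnj w\<close>; averaging the kernels over the arc against bump functions gives
  vectors with summable orbits. A function orthogonal to all of them vanishes along the arc, hence on the line.\<close>

lemma dense_summable_orbits:
  assumes \<Omega>: "open \<Omega>" "connected \<Omega>" and \<phi>: "cholomorphic_on \<phi> \<Omega>" "\<not> \<phi> constant_on \<Omega>"
    and mult: "multiplier \<Omega> ev \<phi>" and z0: "z0 \<in> \<Omega>" "cmod (\<phi> z0) = 1"
  shows "closure {y 0 |y. summable_orbit (cadjoint (mult_op \<Omega> ev \<phi>)) y} = UNIV"
proof -
  let ?M = "mult_op \<Omega> ev \<phi>"
  let ?V = "{y 0 |y. summable_orbit (cadjoint ?M) y}"
  note M = mult_op_bounded_linear[OF mult] mult_op_homogeneous[OF mult]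
  obtain r where r: "r > 0" "ball z0 r \<subseteq> \<Omega>"
    using \<Omega>(1) z0(1) open_contains_ball by blast
  \<comment> \<open>For \<open>w\<close> in \<open>N\<close> the line through \<open>z0\<close> and
    \<open>w\<close> carries two different values of \<open>\<phi>\<close>. As \<open>N\<close> is
    open, it suffices to show that \<open>f\<close> vanishes on it.\<close>
  define N where "N = ball z0 r \<inter> \<phi> -` (- {\<phi> z0})"
  have "open N"
    unfolding N_def using continuous_on_subset[OF cholomorphic_on_imp_continuous_on[OF \<phi>(1)] r(2)]
    by (intro continuous_open_preimage) auto
  have "N \<noteq> {}"
  proof
    assume "N = {}"
    then have ball: "\<phi> z - \<phi> z0 = 0" if "z \<in> ball z0 r" for z
      using that by (auto simp: N_def)
    have "\<phi> z - \<phi> z0 = 0" if "z \<in> \<Omega>" for z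
      by (rule cholomorphic_identity[OF cholomorphic_on_diff_const[OF \<phi>(1)] \<Omega> open_ball _ r(2) ball that])
         (use r(1) in simp)
    then show False
      using \<phi>(2) unfolding constant_on_def by (metis eq_iff_diff_eq_0)
  qed
  have "f = 0" if f: "\<And>v. v \<in> ?V \<Longrightarrow> cinner f v = 0" for f
  proof -
    have zero: "ev f w = 0" if w: "w \<in> N" for w
    proof -
      let ?h = "\<lambda>c. z0 + c *s (w - z0)"
      define D where "D = {c. ?h c \<in> ball z0 r}"
      have D: "open D" "connected D"
        unfolding D_def by (rule line_in_ball)+
      have D01: "0 \<in> D" "1 \<in> D"
        using r w by (auto simp: D_def N_def)
      have hol_line: "(\<lambda>c. F (?h c)) holomorphic_on D" if "cholomorphic_on F \<Omega>" for F
        using r(2) unfolding D_def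
        by (intro holomorphic_on_subset[OF cholomorphic_on_line[OF that \<Omega>(1)]]) auto
      have nc: "\<not> (\<lambda>c. \<phi> (?h c)) constant_on D"
      proof
        assume "(\<lambda>c. \<phi> (?h c)) constant_on D"
        then have "\<phi> (?h 0) = \<phi> (?h 1)"
          using D01 unfolding constant_on_def by metis
        then show False
          using w by (simp add: N_def)
      qed
      have unimodular: "cmod (\<phi> (?h 0)) = 1"
        using z0(2) by simp
      obtain W c w0 where W: "open W" "connected W" "c holomorphic_on W" "open (c ` W)" "c ` W \<subseteq> D"
        and inv: "\<And>w. w \<in> W \<Longrightarrow> \<phi> (?h (c w)) = w" and w0: "w0 \<in> W" "cmod w0 = 1"
        by (rule unimodular_local_inverse[OF hol_line[OF \<phi>(1)] D nc D01(1) unimodular]) (rule that)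
      define E where "E g w = ev g (?h (c w))" for g w
      have in_\<Omega>: "?h (c u) \<in> \<Omega>" if "u \<in> W" for u
      proof -
        have "c u \<in> D"
          using that W(5) by blast
        then show ?thesis
          using r(2) unfolding D_def by blast
      qed
      have E: "E g holomorphic_on W" for g
        unfolding E_def using holomorphic_on_compose_gen[OF W(3) hol_line[OF ev_holomorphic] W(5)]
        by (simp add: o_def)
      have arc: "E f (exp (\<i> * of_real t)) = 0" if t: "exp (\<i> * of_real t) \<in> W" for t
      proof (rule vanishes_if_bump_coefficients_vanish[OF E W(1) t])
        fix a b :: real
        assume ab: "a < b" "\<And>s. s \<in> {a..b} \<Longrightarrow> exp (\<i> * of_real s) \<in> W"
        have lin: "bounded_linear (\<lambda>g. E g u)" if "u \<in> W" for u
          unfolding E_def by (rule ev_bounded_linear[OF in_\<Omega>[OF that]])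
        have hom: "E (x *\<^sub>C g) u = x * E g u" if "u \<in> W" for x g u
          unfolding E_def by (rule ev_scaleC[OF in_\<Omega>[OF that]])
        have ME: "E (?M g) u = u * E g u" if "u \<in> W" for g u
          unfolding E_def ev_mult_op[OF mult in_\<Omega>[OF that]] inv[OF that] ..
        obtain y where "summable_orbit (cadjoint ?M) y" "\<And>g. cinner g (y 0) = bump_coefficient a b (E g) 0"
          by (rule summable_orbit_from_arc[of ?M a b W E,
                OF M less_imp_le[OF ab(1)] W(1) ab(2) E lin hom ME]) (assumption+, rule that)
        then show "bump_coefficient a b (E f) 0 = 0"
          using f[of "y 0"] by auto
      qed
      have circle: "E f u = 0" if "u \<in> sphere 0 1 \<inter> W" for u
        using that arc[of "Arg2pi u"] complex_norm_eq_1_exp[of u] by simp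
      \<comment> \<open>\<open>w0\<close> is a limit point of the circle part of \<open>W\<close>,
        so \<open>E f\<close> vanishes on all of \<open>W\<close>. Hence \<open>ev f\<close> is zero
        along the open parameter set given by the image of \<open>c\<close>, and therefore at the
        parameter 1.\<close>
      have E0: "E f u = 0" if "u \<in> W" for u
        by (rule analytic_continuation[OF E W(1,2) _ w0(1) unit_circle_islimpt[OF w0(2) W(1) w0(1)] circle that])
           auto
      have "ev f (?h 1) = 0"
      proof (rule analytic_continuation_open[OF W(4) D(1) _ D(2) W(5) hol_line[OF ev_holomorphic] holomorphic_on_const _ D01(2)])
        show "c ` W \<noteq> {}" using w0 by auto
        show "ev f (?h u) = 0" if "u \<in> c ` W" for u
          using that E0 unfolding E_def by auto
      qed
      then show ?thesis by simp
    qed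
    show "f = 0"
    proof (rule ev_inject)
      fix z assume z: "z \<in> \<Omega>"
      have "N \<subseteq> \<Omega>"
        using r(2) by (auto simp: N_def)
      then have "ev f z = 0"
        using zero by (intro cholomorphic_identity[OF ev_holomorphic \<Omega> \<open>open N\<close> \<open>N \<noteq> {}\<close> _ _ z])
      then show "ev f z = ev 0 z"
        using ev_zero[OF z] by simp
    qed
  qed
  then show ?thesis
    by (rule dense_if_orthogonal_trivial[OF csubspace_summable_orbits[OF cadjoint_bounded_linear_homogeneous[OF M]]])
qed

end

section \<open>Contractions with an eigenvalue in the open unit disc\<close>

text \<open>Every positive power of \<open>R\<close> moves \<open>x\<close> by at least
  \<open>(1 - cmod c) * norm x\<close>. The radius \<open>e\<close> is half of that: by contraction
  a return to the ball would move \<open>x\<close> by less than \<open>2 * e\<close>.\<close>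

lemma not_recurrent_if_contraction:
  fixes R :: "'a::complex_inner \<Rightarrow> 'a"
  assumes R: "bounded_linear R" "complex_homogeneous R" and contr: "\<And>x. norm (R x) \<le> norm x"
    and eig: "R x = c *\<^sub>C x" "cmod c < 1" "x \<noteq> 0"
  shows "\<not> recurrent R"
proof
  assume rec: "recurrent R"
  define e where "e = (1 - cmod c) * norm x / 2"
  have "e > 0"
    using eig by (simp add: e_def)
  then have "open (ball x e) \<and> ball x e \<noteq> {}"
    by simp
  then obtain n where n: "n \<ge> 1" "ball x e \<inter> (R ^^ n) -` ball x e \<noteq> {}"
    using rec unfolding recurrent_def by blast
  then obtain u where u: "dist x u < e" "dist x ((R ^^ n) u) < e"
    by auto
  interpret Rn: bounded_linear "R ^^ n"
    by (rule bounded_linear_funpow[OF R(1)])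
  have norm_Rn: "norm ((R ^^ m) v) \<le> norm v" for m v
    using contr by (induction m) (auto intro: order_trans)
  have Rn_x: "(R ^^ m) x = (c ^ m) *\<^sub>C x" for m
    using R(2) eig(1) by (induction m) (simp_all add: complex_homogeneous_def scaleC_scaleC mult.commute)
  have "norm ((R ^^ n) u - (R ^^ n) x) < e"
    using norm_Rn[of n "u - x"] u(1) by (simp add: Rn.diff dist_norm norm_minus_commute)
  moreover have "norm (x - (R ^^ n) x) \<le> norm (x - (R ^^ n) u) + norm ((R ^^ n) u - (R ^^ n) x)"
    using norm_triangle_ineq[of "x - (R ^^ n) u" "(R ^^ n) u - (R ^^ n) x"] by simp
  ultimately have less: "norm (x - (R ^^ n) x) < (1 - cmod c) * norm x"
    using u(2) by (simp add: dist_norm e_def)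
  have "norm (x - (R ^^ n) x) = cmod (1 - c ^ n) * norm x"
    unfolding Rn_x by (simp add: norm_scaleC[symmetric] scaleC_diff_left)
  moreover have "1 - cmod c \<le> cmod (1 - c ^ n)"
  proof -
    have "cmod c ^ n \<le> cmod c ^ 1"
      using n(1) eig(2) by (intro power_decreasing) auto
    then show ?thesis
      using norm_triangle_ineq2[of 1 "c ^ n"] by (simp add: norm_power)
  qed
  ultimately show False
    using less mult_right_mono[of "1 - cmod c" "cmod (1 - c ^ n)" "norm x"] by simp
qed

text \<open>Time reversal: if \<open>u\<close> returns to \<open>U\<close> at
  \<open>(T ^^ n) u\<close>, then the latter returns to \<open>u\<close> under
  \<open>R ^^ n\<close>.\<close>

lemma recurrent_if_left_inverse_of_recurrent:
  assumes "recurrent T" and inv: "\<And>x. R (T x) = x"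
  shows "recurrent R"
  unfolding recurrent_def
proof (intro allI impI)
  fix U :: "'a set" assume "open U \<and> U \<noteq> {}"
  then obtain n where n: "n \<ge> 1" "U \<inter> (T ^^ n) -` U \<noteq> {}"
    using assms(1) unfolding recurrent_def by blast
  then obtain u where u: "u \<in> U" "(T ^^ n) u \<in> U"
    by blast
  have "(R ^^ m) ((T ^^ m) u) = u" for m
  proof (induction m)
    case (Suc m)
    then show ?case
      by (metis comp_apply funpow.simps(2) funpow_Suc_right inv)
  qed simp
  then have "(T ^^ n) u \<in> U \<inter> (R ^^ n) -` U"
    using u by simp
  then show "\<exists>k\<ge>1. U \<inter> (R ^^ k) -` U \<noteq> {}"
    using n(1) by blast
qed

context holomorphic_hilbert_space
begin

lemma not_recurrent_if_small:
  assumes mult: "multiplier \<Omega> ev \<psi>" and norm_eq: "onorm (mult_op \<Omega> ev \<psi>) = sup_norm_on \<Omega> \<psi>"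
    and small: "\<And>z. z \<in> \<Omega> \<Longrightarrow> cmod (\<psi> z) < 1" and f: "f \<noteq> (0::'h)" and ne: "\<Omega> \<noteq> {}"
  shows "\<not> recurrent (cadjoint (mult_op \<Omega> ev \<psi>))"
proof -
  note M = mult_op_bounded_linear[OF mult] mult_op_homogeneous[OF mult]
  obtain k where k: "\<And>f z. z \<in> \<Omega> \<Longrightarrow> ev f z = cinner f (k z)"
    using reproducing_kernel_exists by metis
  have "\<exists>z\<in>\<Omega>. ev f z \<noteq> 0"
    using f ev_inject[of f 0] ev_zero by force
  then obtain z where z: "z \<in> \<Omega>" "k z \<noteq> 0"
    using k by fastforce
  \<comment> \<open>The supremum may equal 1, so the norm identity gives only a contraction; the
    strict inequality comes from the eigenvalue at the single point \<open>z\<close>, whose kernel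
    is non-zero.\<close>
  have "sup_norm_on \<Omega> \<psi> \<le> 1"
    unfolding sup_norm_on_def using small ne by (intro cSUP_least) (auto intro: less_imp_le)
  then have "norm (cadjoint (mult_op \<Omega> ev \<psi>) x) \<le> norm x" for x
    using norm_cadjoint_le_onorm[OF M, of x] mult_right_mono[of "onorm (mult_op \<Omega> ev \<psi>)" 1 "norm x"]
    by (simp add: norm_eq)
  moreover have "cadjoint (mult_op \<Omega> ev \<psi>) (k z) = cnj (\<psi> z) *\<^sub>C k z"
    using cadjoint_mult_op_eigenvector[OF mult k z(1)] z(1) by blast
  ultimately show ?thesis
    using small[OF z(1)] z(2) not_recurrent_if_contraction[OF cadjoint_bounded_linear_homogeneous[OF M]] by simp
qed

end

theorem proposition6p1:
  fixes \<Omega> :: "(complex ^ 'n) set"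
    and ev :: "'h::chilbert_space \<Rightarrow> complex ^ 'n \<Rightarrow> complex"
    and \<phi> :: "complex ^ 'n \<Rightarrow> complex"
  assumes "open \<Omega>" and "connected \<Omega>" and "\<Omega> \<noteq> {}"
    and "holomorphic_hilbert_space \<Omega> ev"
    and "\<exists>f::'h. f \<noteq> 0"
    and "\<And>\<psi>. bounded_nonconstant_cholomorphic \<Omega> \<psi> \<Longrightarrow>
           multiplier \<Omega> ev \<psi> \<and> onorm (mult_op \<Omega> ev \<psi>) = sup_norm_on \<Omega> \<psi>"
    and "bounded_nonconstant_cholomorphic \<Omega> \<phi>"
  defines "T \<equiv> cadjoint (mult_op \<Omega> ev \<phi>)"
  shows "(topologically_multiply_recurrent T \<longleftrightarrow> recurrent T)
       \<and> (recurrent T \<longleftrightarrow> frequently_hypercyclic T)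
       \<and> (frequently_hypercyclic T \<longleftrightarrow> hypercyclic T)
       \<and> (hypercyclic T \<longleftrightarrow> \<phi> ` \<Omega> \<inter> sphere 0 1 \<noteq> {})
       \<and> (\<phi> ` \<Omega> \<inter> sphere 0 1 \<noteq> {} \<longleftrightarrow> property_A T)"
proof -
  interpret holomorphic_hilbert_space \<Omega> ev by fact
  note mults = assms(6)
  have \<phi>: "cholomorphic_on \<phi> \<Omega>" "bounded (\<phi> ` \<Omega>)" "\<not> \<phi> constant_on \<Omega>"
    using assms(7) unfolding bounded_nonconstant_cholomorphic_def by auto
  have mult: "multiplier \<Omega> ev \<phi>"
    using mults[OF assms(7)] by blast
  note M = mult_op_bounded_linear[OF mult] mult_op_homogeneous[OF mult]
  have T: "bounded_linear T"
    unfolding T_def by (rule cadjoint_bounded_linear_homogeneous[OF M])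
  obtain f :: 'h where f: "f \<noteq> 0"
    using assms(5) by blast
  have sufficient: "topologically_multiply_recurrent T \<and> frequently_hypercyclic T"
    if ne: "\<phi> ` \<Omega> \<inter> sphere 0 1 \<noteq> {}"
  proof -
    obtain z0 where z0: "z0 \<in> \<Omega>" "cmod (\<phi> z0) = 1"
      using ne by auto
    have dense: "closure {y 0 |y. summable_orbit T y} = UNIV"
      unfolding T_def by (rule dense_summable_orbits[OF assms(1,2) \<phi>(1,3) mult z0])
    obtain A :: "'h set" where A: "countable A" "closure A = UNIV"
      using separable[OF assms(1)] by blast
    obtain s where s: "\<And>n::nat. s n \<in> {y 0 |y. summable_orbit T y}" "closure (range s) = UNIV"
      by (rule dense_sequence_in_dense_set[OF A dense]) (rule that)
    then have "\<forall>n. \<exists>y. s n = y 0 \<and> summable_orbit T y"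
      by blast
    then obtain z where z: "\<And>n. s n = z n 0" "\<And>n. summable_orbit T (z n)"
      by metis
    have "frequently_hypercyclic T"
      using s(2) z by (intro frequently_hypercyclic_if_summable_orbits_dense[OF T, of z]) simp_all
    then show ?thesis
      using multiply_recurrent_if_summable_orbits_dense[OF T dense] by blast
  qed
  have necessary: "\<phi> ` \<Omega> \<inter> sphere 0 1 \<noteq> {}" if rec: "recurrent T"
  proof
    assume empty: "\<phi> ` \<Omega> \<inter> sphere 0 1 = {}"
    have conn: "connected ((\<lambda>z. cmod (\<phi> z)) ` \<Omega>)"
      by (intro connected_continuous_image continuous_on_norm cholomorphic_on_imp_continuous_on \<phi> assms)
    have not1: "1 \<notin> (\<lambda>z. cmod (\<phi> z)) ` \<Omega>"
      using empty by auto
    have "(\<forall>z\<in>\<Omega>. cmod (\<phi> z) < 1) \<or> (\<forall>z\<in>\<Omega>. cmod (\<phi> z) > 1)"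
    proof (rule ccontr)
      assume "\<not> ?thesis"
      then obtain z w where zw: "z \<in> \<Omega>" "1 \<le> cmod (\<phi> z)" "w \<in> \<Omega>" "cmod (\<phi> w) \<le> 1"
        by (auto simp: not_less)
      have "1 \<in> (\<lambda>z. cmod (\<phi> z)) ` \<Omega>"
        by (rule connectedD_interval[OF conn imageI[OF zw(3)] imageI[OF zw(1)] zw(4,2)])
      then show False
        using not1 by blast
    qed
    then show False
    proof
      assume small: "\<forall>z\<in>\<Omega>. cmod (\<phi> z) < 1"
      have "\<not> recurrent T"
        unfolding T_def using mults[OF assms(7)] small
        by (intro not_recurrent_if_small[OF mult _ _ f assms(3)]) auto
      then show False
        using rec by contradiction
    next
      assume big: "\<forall>z\<in>\<Omega>. cmod (\<phi> z) > 1"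
      define \<psi> where "\<psi> z = inverse (\<phi> z)" for z
      have nz: "\<phi> z \<noteq> 0" if "z \<in> \<Omega>" for z
        using big that by force
      have small: "cmod (\<psi> z) < 1" if "z \<in> \<Omega>" for z
        using big that nz[OF that] by (simp add: \<psi>_def norm_inverse inverse_less_1_iff)
      have "cholomorphic_on \<psi> \<Omega>"
        unfolding \<psi>_def by (intro cholomorphic_on_inverse \<phi> nz)
      moreover have "bounded (\<psi> ` \<Omega>)"
        unfolding bounded_iff using small by (auto intro!: exI[of _ 1] less_imp_le)
      moreover have "\<not> \<psi> constant_on \<Omega>"
        using \<phi>(3) unfolding constant_on_def \<psi>_def by (metis inverse_inverse_eq)
      ultimately have \<psi>: "bounded_nonconstant_cholomorphic \<Omega> \<psi>"
        unfolding bounded_nonconstant_cholomorphic_def by blast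
      then have mult': "multiplier \<Omega> ev \<psi>" and norm': "onorm (mult_op \<Omega> ev \<psi>) = sup_norm_on \<Omega> \<psi>"
        using mults by blast+
      note M' = mult_op_bounded_linear[OF mult'] mult_op_homogeneous[OF mult']
      have inv: "mult_op \<Omega> ev \<phi> (mult_op \<Omega> ev \<psi> g) = g" for g
        by (rule ev_inject) (simp add: ev_mult_op mult mult' \<psi>_def nz)
      \<comment> \<open>Adjoints reverse composition, so the right inverse of multiplication by
        \<open>\<phi>\<close> becomes a left inverse of \<open>T\<close>.\<close>
      have "cadjoint (mult_op \<Omega> ev \<psi>) (T x) = x" for x
        unfolding T_def
        by (rule cinner_ext) (simp add: cadjoint_works[OF M', symmetric] cadjoint_works[OF M, symmetric] inv)
      then have "recurrent (cadjoint (mult_op \<Omega> ev \<psi>))"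
        using recurrent_if_left_inverse_of_recurrent[OF rec] by blast
      then show False
        using not_recurrent_if_small[OF mult' norm' small f assms(3)] by blast
    qed
  qed
  \<comment> \<open>A unimodular value gives multiple recurrence and frequent hypercyclicity; the
    latter gives hypercyclicity and property A. Each of these properties gives recurrence, which
    gives back a unimodular value.\<close>
  show ?thesis
    using sufficient necessary recurrent_if_hypercyclic[OF _ f] recurrent_if_property_A
      recurrent_if_multiply_recurrent hypercyclic_if_frequently_hypercyclic
      property_A_if_frequently_hypercyclic by metis
qed

end
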